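(* Let $F:\mathbb{R}_+\to\mathbb{R}$ be measurable, positive and locally bounded. Let $\alpha\in\mathbb{R}$, $\rho\le 0$ and $A\in\mathscr{A}^\infty_\rho$. The following three statements are equivalent. (1) $F\in \mathrm{2RV}^\infty_{\alpha,\rho}(A)$. (2) For some (and hence all) $\theta>-\alpha-\rho$ and some $t_0\ge 0$ with $\int_{t_0}^t s^{\theta-1}F(s)\,ds<\infty$ for all $t\ge t_0$, the following limit holds: $$\lim_{t\to\infty}\frac{1}{A(t)}\Big(\frac{t^\theta F(t)}{\int_{t_0}^t s^{\theta-1}F(s)\,ds}-(\alpha+\theta)\Big)=\frac{\alpha+\theta}{\alpha+\theta+\rho}.$$ In this case, one also has that the function $t\mapsto\int_{t_0}^t s^{\theta-1}F(s)\,ds$ belongs to $\mathrm{2RV}^\infty_{\alpha+\theta,\rho}\big(\frac{\alpha+\theta}{\alpha+\theta+\rho}\cdot A\big)$. (3) For some (and hence all) $\theta<-\alpha$, the following limit holds: $$\lim_{t\to\infty}\frac{1}{A(t)}\Big(\frac{t^\theta F(t)}{\int_t^\infty s^{\theta-1}F(s)\,ds}+(\alpha+\theta)\Big)=-\frac{\alpha+\theta}{\alpha+\theta+\rho}.$$ In this case, one also has that the function $t\mapsto\int_t^\infty s^{\theta-1}F(s)\,ds$ belongs to $\mathrm{2RV}^\infty_{\alpha+\theta,\rho}\big(\frac{\alpha+\theta}{\alpha+\theta+\rho}\cdot A\big)$.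
   Context: A measurable function $F:\mathbb{R}_+\to\mathbb{R}$ is regularly varying at infinity with index $\alpha\in\mathbb{R}$, written $F\in\mathrm{RV}^\infty_\alpha$, if it has constant sign near infinity and $\lim_{t\to\infty}F(tx)/F(t)=x^\alpha$ for every $x>0$. A function $F\in\mathrm{RV}^\infty_\alpha$ belongs to $\mathrm{2RV}^\infty_{\alpha,\rho}(A)$ (second-order regular variation with first-order index $\alpha$, second-order index $\rho$ and auxiliary function $A$, where $A$ is an eventually positive or eventually negative function on $\mathbb{R}_+$) if for every $x>0$ $$\lim_{t\to\infty}\frac{F(tx)/F(t)-x^\alpha}{A(t)}=x^\alpha\int_1^x u^{\rho-1}\,du .$$ For $\rho\le 0$, $\mathscr{A}^\infty_\rho:=\{A\in\mathrm{RV}^\infty_\rho:\lim_{t\to\infty}A(t)=0\}$. *)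

theory Defs
  imports "HOL-Analysis.Analysis"
begin

text \<open>
  Functions on \<open>\<real>\<^sub>+\<close> are represented by total functions \<open>real \<Rightarrow> real\<close> of which only the
  values on \<open>{0<..}\<close> matter. A function that is measurable, positive and locally bounded on
  \<open>{0..}\<close> has these properties on \<open>{0<..}\<close>, so the choice of the open half-line covers
  both conventions for \<open>\<real>\<^sub>+\<close>. Measurable means Borel measurable.
\<close>

definition measurable_pos :: "(real \<Rightarrow> real) \<Rightarrow> bool" where
  "measurable_pos F \<longleftrightarrow> F \<in> borel_measurable (restrict_space borel {0<..})"

definition locally_bounded_pos :: "(real \<Rightarrow> real) \<Rightarrow> bool" where
  "locally_bounded_pos F \<longleftrightarrow> (\<forall>K. compact K \<and> K \<subseteq> {0<..} \<longrightarrow> bounded (F ` K))"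

definition constant_sign_at_top :: "(real \<Rightarrow> real) \<Rightarrow> bool" where
  "constant_sign_at_top F \<longleftrightarrow>
     (\<forall>\<^sub>F t in at_top. F t > 0) \<or> (\<forall>\<^sub>F t in at_top. F t < 0)"

definition RV :: "real \<Rightarrow> (real \<Rightarrow> real) set" where
  "RV \<alpha> = {F. measurable_pos F \<and> constant_sign_at_top F \<and>
     (\<forall>x>0. ((\<lambda>t. F (t * x) / F t) \<longlongrightarrow> x powr \<alpha>) at_top)}"

text \<open>The interval integral is oriented: for \<open>x < 1\<close> it is minus the integral over \<open>[x, 1]\<close>.\<close>

definition RV2 :: "real \<Rightarrow> real \<Rightarrow> (real \<Rightarrow> real) \<Rightarrow> (real \<Rightarrow> real) set" where
  "RV2 \<alpha> \<rho> A = {F. F \<in> RV \<alpha> \<and> constant_sign_at_top A \<and>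
     (\<forall>x>0. ((\<lambda>t. (F (t * x) / F t - x powr \<alpha>) / A t)
        \<longlongrightarrow> x powr \<alpha> * (LBINT u=1..x. u powr (\<rho> - 1))) at_top)}"

definition RV_null :: "real \<Rightarrow> (real \<Rightarrow> real) set" where
  "RV_null \<rho> = {A \<in> RV \<rho>. (A \<longlongrightarrow> 0) at_top}"

definition lower_int :: "(real \<Rightarrow> real) \<Rightarrow> real \<Rightarrow> real \<Rightarrow> real \<Rightarrow> real" where
  "lower_int F \<theta> t\<^sub>0 t = (LINT s:{t\<^sub>0..t}|lborel. s powr (\<theta> - 1) * F s)"

definition upper_int :: "(real \<Rightarrow> real) \<Rightarrow> real \<Rightarrow> real \<Rightarrow> real" where
  "upper_int F \<theta> t = (LINT s:{t..}|lborel. s powr (\<theta> - 1) * F s)"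

text \<open>
  For a measurable positive \<open>F\<close>, finiteness of the integrals is integrability. It is required
  explicitly because the Bochner integral of a non-integrable function is \<open>0\<close>.
\<close>

definition lower_karamata ::
    "(real \<Rightarrow> real) \<Rightarrow> real \<Rightarrow> real \<Rightarrow> (real \<Rightarrow> real) \<Rightarrow> real \<Rightarrow> real \<Rightarrow> bool" where
  "lower_karamata F \<alpha> \<rho> A \<theta> t\<^sub>0 \<longleftrightarrow>
     (\<forall>t\<ge>t\<^sub>0. set_integrable lborel {t\<^sub>0..t} (\<lambda>s. s powr (\<theta> - 1) * F s)) \<and>
     ((\<lambda>t. 1 / A t * (t powr \<theta> * F t / lower_int F \<theta> t\<^sub>0 t - (\<alpha> + \<theta>)))
        \<longlongrightarrow> (\<alpha> + \<theta>) / (\<alpha> + \<theta> + \<rho>)) at_top"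

definition upper_karamata ::
    "(real \<Rightarrow> real) \<Rightarrow> real \<Rightarrow> real \<Rightarrow> (real \<Rightarrow> real) \<Rightarrow> real \<Rightarrow> bool" where
  "upper_karamata F \<alpha> \<rho> A \<theta> \<longleftrightarrow>
     (\<forall>t>0. set_integrable lborel {t..} (\<lambda>s. s powr (\<theta> - 1) * F s)) \<and>
     ((\<lambda>t. 1 / A t * (t powr \<theta> * F t / upper_int F \<theta> t + (\<alpha> + \<theta>)))
        \<longlongrightarrow> - ((\<alpha> + \<theta>) / (\<alpha> + \<theta> + \<rho>))) at_top"

end

theory Submission
  imports Defs
begin

text \<open>
  Put \<open>f t = t\<^sup>\<theta> F t\<close> and \<open>a = \<alpha> + \<theta>\<close>, and let \<open>H\<close> be the integral \<open>\<integral>\<^sub>t\<^sub>0\<^sup>t f s / s ds\<close>, respectively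
  \<open>- \<integral>\<^sub>t\<^sup>\<infinity> f s / s ds\<close>; in both cases \<open>H\<close> is a primitive of \<open>f s / s\<close>, so that the lower and the upper
  statement become one.

  From \<open>F\<close> to the integrals: integrating the second-order relation for \<open>f\<close> over \<open>[t, 2t]\<close> (a Steinhaus
  argument supplies the domination) shows that \<open>D = H - f / a + f A / (a (a + \<rho>))\<close> satisfies
  \<open>D (2t) - D t = o(f t A t)\<close>. Since \<open>B = f A\<close> grows or decays geometrically along \<open>2\<^sup>n t\<close>, telescoping
  gives \<open>D = o(B)\<close>, which is the claimed limit.

  Back: integration by parts turns \<open>H' = f / s\<close> into the Volterra equation
  \<open>y x = 1 + \<integral>\<^sub>1\<^sup>x y u e (t u) / u du\<close> for \<open>y u = u\<^sup>-\<^sup>a H (t u) / H t\<close>, where \<open>e = f / H - a\<close>. As \<open>e\<close> is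
  asymptotic to a multiple of \<open>A\<close>, first \<open>y \<rightarrow> 1\<close> and then \<open>(y - 1) / A t\<close> converges by dominated
  convergence. Finally \<open>f = H (a + e)\<close>.
\<close>

text \<open>The limits are pointwise in x, so nothing may be integrated until the quotients are
  bounded uniformly for x in a compact interval; such bounds suffice, since dominated convergence
  does the rest. The correction term in D is forced. Let k(u) be the integral of v^(\<rho>-1) over
  [1, u]. Inserting f(tu) = f(t) (u^a + A(t) u^a k(u) + o(A(t))) into the integral of f(s)/s over
  [t, 2t] shows that H - f/a has doubling increment (L + o(1)) (2^(a+\<rho>) - 1) B(t) with L =
  -1/(a(a+\<rho>)). This is the leading increment of L B, so D = H - f/a - L B removes it. Then f/H
  - a = -a (H - f/a)/H behaves like -a L A f/H, and f/H -> a yields the constant a/(a+\<rho>). The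
  two ranges of \<theta> are those where a and a+\<rho> have the same sign: either B outgrows the
  constant of integration in H, or B decays and the constant is fixed by H -> 0. On the way back the
  same constant reappears as the solution c of c (1 + \<rho>/a) = 1.\<close>

section \<open>Uniform bounds on compact intervals from pointwise limits\<close>

text \<open>An Egorov-type statement: the exceptional sets decrease in \<open>k\<close>, lie in an
  interval of finite length, and have empty intersection because every point is eventually good;
  continuity of measure from above gives the limit.\<close>

lemma emeasure_exceptional_tendsto_zero:
  fixes P :: "nat \<Rightarrow> real \<Rightarrow> bool" and a b :: real
  assumes meas: "\<And>n. {x \<in> {a..b}. P n x} \<in> sets borel"
    and ev: "\<And>x. x \<in> {a..b} \<Longrightarrow> \<forall>\<^sub>F n in sequentially. P n x"
  shows "(\<lambda>k. emeasure lborel {x \<in> {a..b}. \<exists>n\<ge>k. \<not> P n x}) \<longlonglongrightarrow> 0"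
    and "{x \<in> {a..b}. \<exists>n\<ge>k. \<not> P n x} \<in> sets borel"
proof -
  define B where "B k = {x \<in> {a..b}. \<exists>n\<ge>k. \<not> P n x}" for k
  have B_eq: "B k = (\<Union>n\<in>{k..}. {a..b} - {x \<in> {a..b}. P n x})" for k
    by (auto simp: B_def)
  have "{a..b} - {x \<in> {a..b}. P n x} \<in> sets borel" for n
    by (intro sets.Diff meas) simp
  then have B_sets: "B k \<in> sets borel" for k
    unfolding B_eq by (intro sets.countable_UN') blast+
  then show "{x \<in> {a..b}. \<exists>n\<ge>k. \<not> P n x} \<in> sets borel"
    unfolding B_def .
  have "(\<lambda>k. emeasure lborel (B k)) \<longlonglongrightarrow> emeasure lborel (\<Inter>k. B k)"
  proof (rule Lim_emeasure_decseq)
    show "range B \<subseteq> sets lborel" using B_sets by auto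
    show "decseq B" unfolding decseq_def B_def by (auto intro: order_trans)
    show "emeasure lborel (B i) \<noteq> \<infinity>" for i
    proof -
      have "emeasure lborel (B i) \<le> emeasure lborel {a..b}"
        by (rule emeasure_mono) (auto simp: B_def)
      also have "\<dots> < \<infinity>"
        by (simp add: emeasure_lborel_Icc_eq)
      finally show ?thesis by simp
    qed
  qed
  moreover have "(\<Inter>k. B k) = {}"
  proof -
    have "\<exists>k. x \<notin> B k" for x
    proof (cases "x \<in> {a..b}")
      case True
      with ev[OF True] show ?thesis
        by (auto simp: B_def eventually_sequentially)
    qed (auto simp: B_def)
    then show ?thesis by auto
  qed
  ultimately show "(\<lambda>k. emeasure lborel {x \<in> {a..b}. \<exists>n\<ge>k. \<not> P n x}) \<longlonglongrightarrow> 0"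
    by (simp add: B_def)
qed

text \<open>Steinhaus-type argument: for large \<open>n\<close> the exceptional sets of \<open>P n\<close> and \<open>Q n\<close> are so
  small that the dilate of one and the other cannot cover \<open>{1..2}\<close>.\<close>

lemma eventually_common_point:
  fixes P Q :: "nat \<Rightarrow> real \<Rightarrow> bool" and u :: "nat \<Rightarrow> real"
  assumes u: "\<And>n. u n \<in> {1..K}"
    and measP: "\<And>n. {x \<in> {1..2*K}. P n x} \<in> sets borel"
    and measQ: "\<And>n. {x \<in> {1..2}. Q n x} \<in> sets borel"
    and evP: "\<And>x. x \<in> {1..2*K} \<Longrightarrow> \<forall>\<^sub>F n in sequentially. P n x"
    and evQ: "\<And>x. x \<in> {1..2} \<Longrightarrow> \<forall>\<^sub>F n in sequentially. Q n x"
  shows "\<forall>\<^sub>F n in sequentially. \<exists>w\<in>{1..2}. P n (u n * w) \<and> Q n w"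
proof -
  define B where "B k = {x \<in> {1..2*K}. \<exists>n\<ge>k. \<not> P n x}" for k
  define C where "C k = {x \<in> {1..2}. \<exists>n\<ge>k. \<not> Q n x}" for k
  have BC [measurable]: "B k \<in> sets borel" "C k \<in> sets borel" for k
    unfolding B_def C_def
    using emeasure_exceptional_tendsto_zero(2)[OF measP evP, of k]
      emeasure_exceptional_tendsto_zero(2)[OF measQ evQ, of k] by blast+
  have "(\<lambda>k. emeasure lborel (B k)) \<longlonglongrightarrow> 0" "(\<lambda>k. emeasure lborel (C k)) \<longlonglongrightarrow> 0"
    unfolding B_def C_def
    using emeasure_exceptional_tendsto_zero(1)[OF measP evP]
      emeasure_exceptional_tendsto_zero(1)[OF measQ evQ] by blast+
  then have "\<forall>\<^sub>F k in sequentially. emeasure lborel (B k) < ennreal (1/4)"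
    "\<forall>\<^sub>F k in sequentially. emeasure lborel (C k) < ennreal (1/4)"
    by (auto intro!: order_tendstoD)
  then show ?thesis
  proof eventually_elim
    case (elim k)
    \<comment> \<open>\<open>B'\<close> collects the \<open>w\<close> for which
      \<open>u k * w\<close> is exceptional for \<open>P\<close>. It is \<open>B k\<close> scaled by
      \<open>1 / u k\<close>, and \<open>u k \<ge> 1\<close>, so it is no longer than
      \<open>B k\<close>; together with \<open>C k\<close> it has length below 1/2 and cannot cover
      [1, 2].\<close>
    define B' where "B' = (\<lambda>w. u k * w) -` B k"
    have B'_sets [measurable]: "B' \<in> sets borel"
      unfolding B'_def by (rule measurable_sets_borel[of _ borel]) simp_all
    have uk: "u k \<ge> 1" using u[of k] by auto
    have "emeasure lborel B' \<le> ennreal \<bar>u k\<bar> * emeasure lborel B'"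
      using uk mult_right_mono[of 1 "ennreal \<bar>u k\<bar>" "emeasure lborel B'"]
      by simp
    also have "\<dots> = emeasure lborel (B k)"
    proof -
      have "(\<integral>\<^sup>+ x. indicator (B k) x \<partial>lborel) = ennreal \<bar>u k\<bar> * (\<integral>\<^sup>+ x. indicator (B k) (0 + u k * x) \<partial>lborel)"
        using uk by (intro nn_integral_real_affine) auto
      also have "(\<lambda>x. indicator (B k) (0 + u k * x) :: ennreal) = indicator B'"
        by (auto simp: B'_def indicator_def fun_eq_iff)
      finally show ?thesis by simp
    qed
    finally have B': "emeasure lborel B' < ennreal (1/4)" using elim by auto
    show ?case
    proof (rule ccontr)
      assume no: "\<not> ?case"
      have "{1..2} \<subseteq> B' \<union> C k"
      proof
        fix w :: real assume w: "w \<in> {1..2}"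
        then have "\<not> P k (u k * w) \<or> \<not> Q k w" using no by blast
        moreover have "u k * w \<in> {1..2*K}"
          using w u[of k] mult_mono[of 1 "u k" 1 w] mult_mono[of "u k" K w 2] by auto
        ultimately show "w \<in> B' \<union> C k"
          using w by (auto simp: B'_def B_def C_def)
      qed
      then have "emeasure lborel {1..2::real} \<le> emeasure lborel (B' \<union> C k)"
        by (intro emeasure_mono) auto
      also have "\<dots> \<le> emeasure lborel B' + emeasure lborel (C k)"
        by (intro emeasure_subadditive) auto
      also have "\<dots> < ennreal (1/4) + ennreal (1/4)"
        using B' elim by (intro add_strict_mono) auto
      also have "\<dots> = ennreal (1/2)"
        by (subst ennreal_plus[symmetric]) auto
      finally have "ennreal 1 < ennreal (1/2)" by simp
      then show False by (subst (asm) ennreal_less_iff) auto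
    qed
  qed
qed

text \<open>If the bound failed, there would be \<open>s n\<close> tending to infinity and
  \<open>u n\<close> in [1, K] with unbounded ratios. At a common point \<open>w\<close> the ratio
  g(s u w)/g(s) is bounded above and g(s u w)/g(s u) is bounded below; their quotient is g(s
  u)/g(s), a contradiction. This is the boundedness part of the uniform convergence theorem.\<close>

lemma regular_variation_locally_bounded:
  fixes g :: "real \<Rightarrow> real"
  assumes [measurable]: "g \<in> borel_measurable borel"
    and nz: "\<forall>\<^sub>F t in at_top. g t \<noteq> 0"
    and lim: "\<And>x. x \<ge> 1 \<Longrightarrow> ((\<lambda>t. g (t * x) / g t) \<longlongrightarrow> x powr \<rho>) at_top"
    and K: "K \<ge> 1"
  obtains C T where "C > 0" "T > 0" "\<And>t x. t \<ge> T \<Longrightarrow> x \<in> {1..K} \<Longrightarrow> \<bar>g (t * x) / g t\<bar> \<le> C"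
proof -
  obtain T0 where T0: "\<And>t. t \<ge> T0 \<Longrightarrow> g t \<noteq> 0"
    using nz by (auto simp: eventually_at_top_linorder)
  \<comment> \<open>\<open>C0\<close> lies above the limits x^\<rho> on [1, 2K], the range of the
    products \<open>u n * w\<close>; \<open>c0\<close> lies below them on [1, 2], the range of
    \<open>w\<close>. Both inequalities are strict, so that the ratios inherit them
    eventually.\<close>
  define C0 where "C0 = (2*K) powr \<bar>\<rho>\<bar> + 1"
  have bd: "x powr \<rho> < C0" if "x \<in> {1..2*K}" for x
  proof -
    have "x powr \<rho> \<le> x powr \<bar>\<rho>\<bar>" using that by (intro powr_mono) auto
    also have "\<dots> \<le> (2*K) powr \<bar>\<rho>\<bar>" using that by (intro powr_mono2) auto
    finally show ?thesis by (simp add: C0_def)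
  qed
  define c0 :: real where "c0 = 2 powr (- \<bar>\<rho>\<bar>) / 2"
  have c0: "c0 > 0" by (simp add: c0_def)
  have bd2: "x powr \<rho> > c0" if "x \<in> {1..2}" for x
  proof -
    have "c0 < 2 powr (- \<bar>\<rho>\<bar>)" by (simp add: c0_def)
    also have "\<dots> \<le> x powr (- \<bar>\<rho>\<bar>)" using that by (intro powr_mono2') auto
    also have "\<dots> \<le> x powr \<rho>" using that by (intro powr_mono) auto
    finally show ?thesis .
  qed
  have "\<exists>n. \<forall>t\<ge>max (real n) 1. \<forall>x\<in>{1..K}. \<bar>g (t * x) / g t\<bar> \<le> real n + 1"
  proof (rule ccontr)
    assume "\<not> ?thesis"
    then have "\<forall>n. \<exists>t x. t \<ge> max (real n) 1 \<and> x \<in> {1..K} \<and> \<bar>g (t * x) / g t\<bar> > real n + 1"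
      unfolding not_ex not_all Ball_def not_imp not_le by blast
    then obtain s u where s: "\<And>n. s n \<ge> max (real n) 1" and u: "\<And>n. u n \<in> {1..K}"
      and big: "\<And>n. \<bar>g (s n * u n) / g (s n)\<bar> > real n + 1"
      by metis
    have s_top: "filterlim s at_top sequentially"
      by (rule filterlim_at_top_mono[OF filterlim_real_sequentially]) (use s in auto)
    have su_ge: "s n * u n \<ge> s n" for n
      using s[of n] u[of n] by (simp add: mult_le_cancel_left1)
    have su_top: "filterlim (\<lambda>n. s n * u n) at_top sequentially"
      by (rule filterlim_at_top_mono[OF s_top]) (use su_ge in auto)
    have "\<forall>\<^sub>F n in sequentially. \<exists>w\<in>{1..2}. \<bar>g (s n * (u n * w)) / g (s n)\<bar> < C0
        \<and> \<bar>g (s n * u n * w) / g (s n * u n)\<bar> > c0"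
    proof (rule eventually_common_point[OF u])
      show "{x \<in> {1..2 * K}. \<bar>g (s n * x) / g (s n)\<bar> < C0} \<in> sets borel" for n
        by measurable
      show "{x \<in> {1..2}. c0 < \<bar>g (s n * u n * x) / g (s n * u n)\<bar>} \<in> sets borel" for n
        by measurable
      show "\<forall>\<^sub>F n in sequentially. \<bar>g (s n * x) / g (s n)\<bar> < C0" if "x \<in> {1..2*K}" for x
      proof -
        have "((\<lambda>t. \<bar>g (t * x) / g t\<bar>) \<longlongrightarrow> \<bar>x powr \<rho>\<bar>) at_top"
          using that by (intro tendsto_rabs lim) auto
        then have "(\<lambda>n. \<bar>g (s n * x) / g (s n)\<bar>) \<longlonglongrightarrow> \<bar>x powr \<rho>\<bar>"
          by (rule filterlim_compose[OF _ s_top])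
        then show ?thesis using bd[OF that] by (intro order_tendstoD(2)[of _ "\<bar>x powr \<rho>\<bar>"]) auto
      qed
      show "\<forall>\<^sub>F n in sequentially. c0 < \<bar>g (s n * u n * x) / g (s n * u n)\<bar>" if "x \<in> {1..2}" for x
      proof -
        have "((\<lambda>t. \<bar>g (t * x) / g t\<bar>) \<longlongrightarrow> \<bar>x powr \<rho>\<bar>) at_top"
          using that by (intro tendsto_rabs lim) auto
        then have "(\<lambda>n. \<bar>g (s n * u n * x) / g (s n * u n)\<bar>) \<longlonglongrightarrow> \<bar>x powr \<rho>\<bar>"
          by (rule filterlim_compose[OF _ su_top])
        then show ?thesis using bd2[OF that] by (intro order_tendstoD(1)[of _ "\<bar>x powr \<rho>\<bar>"]) auto
      qed
    qed
    moreover have "\<forall>\<^sub>F n in sequentially. real n > C0 / c0"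
      using filterlim_real_sequentially by (simp add: filterlim_at_top_dense)
    moreover have "\<forall>\<^sub>F n in sequentially. s n \<ge> T0"
      using s_top by (simp add: filterlim_at_top)
    ultimately have "\<forall>\<^sub>F n in sequentially. False"
    proof eventually_elim
      case (elim n)
      then obtain w where w: "w \<in> {1..2}" "\<bar>g (s n * (u n * w)) / g (s n)\<bar> < C0"
        "\<bar>g (s n * u n * w) / g (s n * u n)\<bar> > c0" by auto
      have nz: "g (s n) \<noteq> 0" "g (s n * u n) \<noteq> 0"
        using T0 elim su_ge[of n] by auto
      have "c0 * \<bar>g (s n * u n) / g (s n)\<bar> \<le> \<bar>g (s n * u n * w) / g (s n * u n)\<bar> * \<bar>g (s n * u n) / g (s n)\<bar>"
        using w by (intro mult_right_mono) auto
      also have "\<dots> = \<bar>g (s n * (u n * w)) / g (s n)\<bar>"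
        using nz by (simp add: abs_mult mult.assoc)
      also have "\<dots> < C0" by fact
      finally have "\<bar>g (s n * u n) / g (s n)\<bar> < C0 / c0"
        using c0 by (simp add: pos_less_divide_eq mult.commute)
      then show False using big[of n] elim by auto
    qed
    then show False by simp
  qed
  then obtain n where "\<forall>t\<ge>max (real n) 1. \<forall>x\<in>{1..K}. \<bar>g (t * x) / g t\<bar> \<le> real n + 1" by auto
  then show ?thesis
    by (intro that[of "real n + 1" "max (real n) 1"]) simp_all
qed

section \<open>The limit function of second-order regular variation\<close>

text \<open>The primitive of u^(\<rho>-1) that vanishes at 1, known as the Box-Cox transform; the
  logarithm is the limit of the other branch as \<rho> -> 0.\<close>

definition power_kernel :: "real \<Rightarrow> real \<Rightarrow> real" where
  "power_kernel \<rho> x = (if \<rho> = 0 then ln x else (x powr \<rho> - 1) / \<rho>)"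

lemma power_kernel_has_derivative:
  assumes "x > 0"
  shows "(power_kernel \<rho> has_real_derivative x powr (\<rho> - 1)) (at x)"
proof (cases "\<rho> = 0")
  case True
  then have "power_kernel \<rho> = ln" by (simp add: power_kernel_def fun_eq_iff)
  with assms True show ?thesis
    by (auto intro!: derivative_eq_intros simp: powr_minus field_simps)
next
  case False
  then have "power_kernel \<rho> = (\<lambda>x. (x powr \<rho> - 1) / \<rho>)" by (simp add: power_kernel_def fun_eq_iff)
  with assms False show ?thesis
    by (auto intro!: derivative_eq_intros)
qed

lemma interval_integral_powr_eq_power_kernel:
  assumes "x > 0"
  shows "(LBINT u=1..x. u powr (\<rho> - 1)) = power_kernel \<rho> x"
proof -
  have "(LBINT u=ereal 1..ereal x. u powr (\<rho> - 1)) = power_kernel \<rho> x - power_kernel \<rho> 1"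
  proof (rule interval_integral_FTC_finite)
    show "continuous_on {min 1 x..max 1 x} (\<lambda>u. u powr (\<rho> - 1))"
      using assms by (intro continuous_intros) auto
    show "(power_kernel \<rho> has_vector_derivative u powr (\<rho> - 1)) (at u within {min 1 x..max 1 x})"
      if "min 1 x \<le> u" "u \<le> max 1 x" for u
    proof -
      have "u > 0" using that assms by auto
      then show ?thesis
        by (rule has_vector_derivative_at_within[OF power_kernel_has_derivative
              [unfolded has_real_derivative_iff_has_vector_derivative]])
    qed
  qed
  then show ?thesis by (simp add: power_kernel_def one_ereal_def)
qed

lemma power_kernel_borel [measurable]: "power_kernel \<rho> \<in> borel_measurable borel"
  unfolding power_kernel_def by measurable

lemma continuous_on_power_kernel:
  assumes "0 < a"
  shows "continuous_on {a..b} (power_kernel \<rho>)"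
proof (rule continuous_at_imp_continuous_on, rule ballI)
  fix x assume "x \<in> {a..b}"
  then show "isCont (power_kernel \<rho>) x"
    using power_kernel_has_derivative[of x \<rho>] assms DERIV_isCont by auto
qed

text \<open>The cocycle rule k(xy) = k(x) + x^\<rho> k(y) at y = 1/x, where k(1) = 0. It carries
  second-order limits from dilations above 1 to dilations below 1.\<close>

lemma power_kernel_inverse:
  assumes "x > 0"
  shows "x powr \<rho> * power_kernel \<rho> (1 / x) = - power_kernel \<rho> x"
  using assms by (auto simp: power_kernel_def ln_div powr_divide field_simps)

lemma power_kernel_bounded:
  obtains M where "M > 0" "\<And>x. x \<in> {1..K} \<Longrightarrow> \<bar>x powr a * power_kernel \<rho> x\<bar> \<le> M"
proof -
  have "compact ((\<lambda>x. x powr a * power_kernel \<rho> x) ` {1..K})"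
    by (intro compact_continuous_image continuous_intros continuous_on_power_kernel) auto
  then have "bounded ((\<lambda>x. x powr a * power_kernel \<rho> x) ` {1..K})"
    by (rule compact_imp_bounded)
  then obtain M where "M > 0" "\<And>y. y \<in> (\<lambda>x. x powr a * power_kernel \<rho> x) ` {1..K} \<Longrightarrow> norm y \<le> M"
    by (auto simp: bounded_pos)
  then show ?thesis by (intro that[of M]) auto
qed

lemma filterlim_mult_const_at_top:
  "0 < (x::real) \<Longrightarrow> filterlim (\<lambda>t. t * x) at_top at_top"
  by (rule filterlim_at_top_mult_tendsto_pos[OF tendsto_const _ filterlim_ident])

section \<open>Second-order relations relative to a null auxiliary function\<close>

text \<open>Here \<open>A\<close> is total and Borel, so its dilates and quotients are Borel on the
  whole line; the auxiliary function of the theorem enters through its extension by zero.\<close>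

locale null_RV =
  fixes A :: "real \<Rightarrow> real" and \<rho> :: real
  assumes A_borel [measurable]: "A \<in> borel_measurable borel"
    and A_nonzero: "\<forall>\<^sub>F t in at_top. A t \<noteq> 0"
    and A_ratio: "\<And>x. x > 0 \<Longrightarrow> ((\<lambda>t. A (t * x) / A t) \<longlongrightarrow> x powr \<rho>) at_top"
    and A_null: "(A \<longlongrightarrow> 0) at_top"
begin

lemma A_locally_bounded:
  assumes "K \<ge> 1"
  obtains C T where "C > 0" "T > 0" "\<And>t x. t \<ge> T \<Longrightarrow> x \<in> {1..K} \<Longrightarrow> \<bar>A (t * x) / A t\<bar> \<le> C"
  using regular_variation_locally_bounded[OF A_borel A_nonzero A_ratio assms] by auto

text \<open>Since \<open>A\<close> tends to 0, a finite second-order limit forces the first-order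
  one. First-order regular variation therefore never has to be carried along separately.\<close>

lemma ratio_of_second_order:
  assumes "((\<lambda>t. (r t - p) / A t) \<longlongrightarrow> l) at_top"
  shows "(r \<longlongrightarrow> p) at_top"
proof -
  have "((\<lambda>t. (r t - p) / A t * A t + p) \<longlongrightarrow> l * 0 + p) at_top"
    by (intro tendsto_intros assms A_null)
  then have "((\<lambda>t. (r t - p) / A t * A t + p) \<longlongrightarrow> p) at_top" by simp
  moreover have "\<forall>\<^sub>F t in at_top. (r t - p) / A t * A t + p = r t"
    using A_nonzero by eventually_elim simp
  ultimately show ?thesis
    by (rule Lim_transform_eventually)
qed

text \<open>For x < 1 the ratio H(tx)/H(t) is the reciprocal of the ratio with base point tx and
  dilation 1/x > 1. Replacing A(tx) by A(t) costs a factor x^\<rho>, which the reflection rule of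
  the kernel absorbs. The analysis can thus stay with x \<ge> 1, where increments of
  \<open>H\<close> are integrals over [t, tx].\<close>

lemma second_order_extend:
  fixes H :: "real \<Rightarrow> real"
  assumes H: "\<forall>\<^sub>F t in at_top. H t \<noteq> 0"
    and lim: "\<And>x. x \<ge> 1 \<Longrightarrow>
      ((\<lambda>t. (H (t * x) / H t - x powr a) / A t) \<longlongrightarrow> c * (x powr a * power_kernel \<rho> x)) at_top"
    and x: "x > 0"
  shows "((\<lambda>t. (H (t * x) / H t - x powr a) / A t) \<longlongrightarrow> c * (x powr a * power_kernel \<rho> x)) at_top"
proof (cases "x \<ge> 1")
  case True
  then show ?thesis by (rule lim)
next
  case False
  define z where "z = 1 / x"
  have z: "z > 1" "z > 0" "x * z = 1" using False x by (auto simp: z_def)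
  define r where "r s = H (s * z) / H s" for s
  have lz: "((\<lambda>s. (r s - z powr a) / A s) \<longlongrightarrow> c * (z powr a * power_kernel \<rho> z)) at_top"
    unfolding r_def using z by (intro lim) auto
  have tx: "filterlim (\<lambda>t. t * x) at_top at_top" using x by (rule filterlim_mult_const_at_top)
  have lz': "((\<lambda>t. (r (t * x) - z powr a) / A (t * x)) \<longlongrightarrow> c * (z powr a * power_kernel \<rho> z)) at_top"
    by (rule filterlim_compose[OF lz tx])
  have lr: "((\<lambda>t. r (t * x)) \<longlongrightarrow> z powr a) at_top"
    by (rule filterlim_compose[OF ratio_of_second_order[OF lz] tx])
  have za: "z powr a = 1 / x powr a" using x by (simp add: z_def powr_divide)
  \<comment> \<open>With r = \<open>r (t * x)\<close> this is the identity 1/r - x^a = -x^a (r -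
    z^a)/r, valid because z^a = x^(-a).\<close>
  have "((\<lambda>t. - (x powr a) * ((r (t * x) - z powr a) / A (t * x)) * (A (t * x) / A t) / r (t * x))
      \<longlongrightarrow> - (x powr a) * (c * (z powr a * power_kernel \<rho> z)) * x powr \<rho> / z powr a) at_top"
    using z by (intro tendsto_intros lz' lr A_ratio x) auto
  also have "- (x powr a) * (c * (z powr a * power_kernel \<rho> z)) * x powr \<rho> / z powr a
      = c * (x powr a * - (x powr \<rho> * power_kernel \<rho> (1/x)))"
    using z by (simp add: z_def)
  also have "\<dots> = c * (x powr a * power_kernel \<rho> x)"
    using power_kernel_inverse[OF x, of \<rho>] by simp
  finally have main: "((\<lambda>t. - (x powr a) * ((r (t * x) - z powr a) / A (t * x)) * (A (t * x) / A t) / r (t * x))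
      \<longlongrightarrow> c * (x powr a * power_kernel \<rho> x)) at_top" .
  have nzx: "\<forall>\<^sub>F t in at_top. A (t * x) \<noteq> 0" "\<forall>\<^sub>F t in at_top. H (t * x) \<noteq> 0"
    using filterlim_iff[THEN iffD1, OF tx, rule_format] A_nonzero H by auto
  have "\<forall>\<^sub>F t in at_top. - (x powr a) * ((r (t * x) - z powr a) / A (t * x)) * (A (t * x) / A t) / r (t * x)
      = (H (t * x) / H t - x powr a) / A t"
    using nzx A_nonzero H
  proof eventually_elim
    case (elim t)
    have rt: "r (t * x) = H t / H (t * x)" using z by (simp add: r_def mult.assoc)
    have p: "x powr a > 0" using x by simp
    show ?case unfolding rt za using elim p by (simp add: divide_simps)
  qed
  with main show ?thesis
    by (rule Lim_transform_eventually)
qed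

text \<open>The Steinhaus argument again, except that the second-order quotient \<open>q\<close> is
  not multiplicative. With p = f(su)/f(s), multiplicativity of the ratios of \<open>f\<close> gives
  p (w^a + e2 A(su)) = u^a w^a + e1 A(s) with bounded \<open>e1\<close>, \<open>e2\<close>;
  subtracting u^a (w^a + e2 A(su)) isolates p - u^a. It is O(A(s)) because w^a + e2 A(su) stays away
  from 0 and A(su) = O(A(s)) by the local bound for \<open>A\<close>.\<close>

lemma second_order_locally_bounded:
  fixes f :: "real \<Rightarrow> real"
  assumes [measurable]: "f \<in> borel_measurable borel"
    and nz: "\<forall>\<^sub>F t in at_top. f t \<noteq> 0"
    and lim: "\<And>x. x \<ge> 1 \<Longrightarrow>
      ((\<lambda>t. (f (t * x) / f t - x powr a) / A t) \<longlongrightarrow> x powr a * power_kernel \<rho> x) at_top"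
    and K: "K \<ge> 1"
  obtains C T where "C > 0" "T > 0"
    "\<And>t x. t \<ge> T \<Longrightarrow> x \<in> {1..K} \<Longrightarrow> \<bar>(f (t * x) / f t - x powr a) / A t\<bar> \<le> C"
proof -
  define q where "q t x = (f (t * x) / f t - x powr a) / A t" for t x
  have [measurable]: "q t \<in> borel_measurable borel" for t
    unfolding q_def by measurable
  obtain M0 where M0: "M0 > 0" "\<And>x. x \<in> {1..2*K} \<Longrightarrow> \<bar>x powr a * power_kernel \<rho> x\<bar> \<le> M0"
    using power_kernel_bounded[of "2*K" a \<rho>] by blast
  define M where "M = M0 + 1"
  have M: "M > 0" "\<And>x. x \<in> {1..2*K} \<Longrightarrow> \<bar>x powr a * power_kernel \<rho> x\<bar> < M"
    using M0 by (fastforce simp: M_def)+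
  obtain CA TA where CA: "CA > 0" "\<And>t x. t \<ge> TA \<Longrightarrow> x \<in> {1..K} \<Longrightarrow> \<bar>A (t * x) / A t\<bar> \<le> CA"
    using A_locally_bounded[OF K] by metis
  define m :: real where "m = 2 powr (- \<bar>a\<bar>)"
  have m: "m > 0" by (simp add: m_def)
  have m_le: "m \<le> w powr a" if "w \<in> {1..2}" for w
  proof -
    have "m \<le> w powr (- \<bar>a\<bar>)" using that unfolding m_def by (intro powr_mono2') auto
    also have "\<dots> \<le> w powr a" using that by (intro powr_mono) auto
    finally show ?thesis .
  qed
  define L where "L = K powr \<bar>a\<bar>"
  have L_ge: "u powr a \<le> L" if "u \<in> {1..K}" for u
  proof -
    have "u powr a \<le> u powr \<bar>a\<bar>" using that by (intro powr_mono) auto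
    also have "\<dots> \<le> L" using that unfolding L_def by (intro powr_mono2) auto
    finally show ?thesis .
  qed
  have L: "L > 0" using K by (simp add: L_def)
  \<comment> \<open>\<open>m\<close> bounds w^a from below on [1, 2] and \<open>L\<close> bounds u^a
    from above on [1, K]. The bracket bounds e1 A(s) - u^a e2 A(su) relative to A(s); the factor 2/m
    is the reciprocal of the lower bound m/2 for w^a + e2 A(su), which the smallness m/(2M) of
    \<open>A\<close> required next ensures, as |e2| < M.\<close>
  define D where "D = (M + L * M * CA) * 2 / m"
  have "\<forall>\<^sub>F t in at_top. dist (A t) 0 < m / (2 * M)"
    using A_null M m by (intro tendstoD) auto
  with nz A_nonzero obtain T0 where
    T0: "\<And>t. t \<ge> T0 \<Longrightarrow> f t \<noteq> 0 \<and> A t \<noteq> 0 \<and> \<bar>A t\<bar> < m / (2 * M)"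
    unfolding eventually_at_top_linorder dist_real_def diff_0_right
    by (metis le_max_iff_disj linorder_le_cases order_trans)
  have "\<exists>n. \<forall>t\<ge>max (real n) 1. \<forall>x\<in>{1..K}. \<bar>q t x\<bar> \<le> real n + 1"
  proof (rule ccontr)
    assume "\<not> ?thesis"
    then have "\<forall>n. \<exists>t x. t \<ge> max (real n) 1 \<and> x \<in> {1..K} \<and> \<bar>q t x\<bar> > real n + 1"
      unfolding not_ex not_all Ball_def not_imp not_le by blast
    then obtain s u where s: "\<And>n. s n \<ge> max (real n) 1" and u: "\<And>n. u n \<in> {1..K}"
      and big: "\<And>n. \<bar>q (s n) (u n)\<bar> > real n + 1"
      by metis
    have s_top: "filterlim s at_top sequentially"
      by (rule filterlim_at_top_mono[OF filterlim_real_sequentially]) (use s in auto)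
    have su_ge: "s n * u n \<ge> s n" for n
      using s[of n] u[of n] by (simp add: mult_le_cancel_left1)
    have su_top: "filterlim (\<lambda>n. s n * u n) at_top sequentially"
      by (rule filterlim_at_top_mono[OF s_top]) (use su_ge in auto)
    have ev: "\<forall>\<^sub>F n in sequentially. \<bar>q (\<sigma> n) x\<bar> < M"
      if "x \<in> {1..2*K}" "filterlim \<sigma> at_top sequentially" for x and \<sigma> :: "nat \<Rightarrow> real"
    proof -
      have "((\<lambda>t. \<bar>q t x\<bar>) \<longlongrightarrow> \<bar>x powr a * power_kernel \<rho> x\<bar>) at_top"
        unfolding q_def using that by (intro tendsto_rabs lim) auto
      then have "(\<lambda>n. \<bar>q (\<sigma> n) x\<bar>) \<longlonglongrightarrow> \<bar>x powr a * power_kernel \<rho> x\<bar>"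
        by (rule filterlim_compose[OF _ that(2)])
      then show ?thesis using M(2)[OF that(1)]
        by (intro order_tendstoD(2)[of _ "\<bar>x powr a * power_kernel \<rho> x\<bar>"]) auto
    qed
    have "\<forall>\<^sub>F n in sequentially. \<exists>w\<in>{1..2}. \<bar>q (s n) (u n * w)\<bar> < M
        \<and> \<bar>q (s n * u n) w\<bar> < M"
    proof (rule eventually_common_point[OF u])
      show "{x \<in> {1..2 * K}. \<bar>q (s n) x\<bar> < M} \<in> sets borel" for n
        by measurable
      show "{x \<in> {1..2}. \<bar>q (s n * u n) x\<bar> < M} \<in> sets borel" for n
        by measurable
      show "\<forall>\<^sub>F n in sequentially. \<bar>q (s n) x\<bar> < M" if "x \<in> {1..2*K}" for x
        using that s_top by (rule ev)
      show "\<forall>\<^sub>F n in sequentially. \<bar>q (s n * u n) x\<bar> < M" if "x \<in> {1..2}" for x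
        using that K by (intro ev su_top) auto
    qed
    moreover have "\<forall>\<^sub>F n in sequentially. real n > D"
      using filterlim_real_sequentially by (simp add: filterlim_at_top_dense)
    moreover have "\<forall>\<^sub>F n in sequentially. s n \<ge> max T0 TA"
      using filterlim_at_top[THEN iffD1, OF s_top] by blast
    ultimately have "\<forall>\<^sub>F n in sequentially. False"
    proof eventually_elim
      case (elim n)
      then obtain w where w: "w \<in> {1..2}" "\<bar>q (s n) (u n * w)\<bar> < M" "\<bar>q (s n * u n) w\<bar> < M"
        by auto
      define p where "p = f (s n * u n) / f (s n)"
      define A0 where "A0 = A (s n)"
      define A1 where "A1 = A (s n * u n)"
      define e1 where "e1 = q (s n) (u n * w)"
      define e2 where "e2 = q (s n * u n) w"
      have nz: "f (s n) \<noteq> 0" "f (s n * u n) \<noteq> 0" "A0 \<noteq> 0" "A1 \<noteq> 0" "\<bar>A1\<bar> < m / (2 * M)"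
        using T0[of "s n"] T0[of "s n * u n"] elim su_ge[of n] by (auto simp: A0_def A1_def)
      have e1: "f (s n * (u n * w)) / f (s n) = u n powr a * w powr a + e1 * A0"
        using nz u[of n] w(1) by (simp add: e1_def q_def A0_def powr_mult)
      have e2: "f (s n * u n * w) / f (s n * u n) = w powr a + e2 * A1"
        using nz by (simp add: e2_def q_def A1_def)
      have "p * (w powr a + e2 * A1) = u n powr a * w powr a + e1 * A0"
        unfolding e1[symmetric] e2[symmetric] using nz by (simp add: p_def mult.assoc)
      then have eq: "(p - u n powr a) * (w powr a + e2 * A1) = e1 * A0 - u n powr a * e2 * A1"
        by (simp add: algebra_simps)
      have "\<bar>e2 * A1\<bar> \<le> M * (m / (2 * M))"
        unfolding abs_mult using w nz by (intro mult_mono) (auto simp: e2_def)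
      also have "\<dots> = m / 2" using M by simp
      finally have low: "w powr a + e2 * A1 \<ge> m / 2"
        using m_le[OF w(1)] by linarith
      have A1_le: "\<bar>A1\<bar> \<le> CA * \<bar>A0\<bar>"
        using CA(2)[of "s n" "u n"] elim u nz by (auto simp: A0_def A1_def abs_divide divide_simps)
      have "\<bar>p - u n powr a\<bar> * (m / 2) \<le> \<bar>p - u n powr a\<bar> * (w powr a + e2 * A1)"
        using low by (intro mult_left_mono) auto
      also have "\<dots> = \<bar>e1 * A0 - u n powr a * e2 * A1\<bar>"
        using low m by (simp add: eq[symmetric] abs_mult)
      also have "\<dots> \<le> \<bar>e1\<bar> * \<bar>A0\<bar> + u n powr a * \<bar>e2\<bar> * \<bar>A1\<bar>"
        by (rule order_trans[OF abs_triangle_ineq4]) (simp add: abs_mult)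
      also have "\<dots> \<le> M * \<bar>A0\<bar> + L * M * (CA * \<bar>A0\<bar>)"
        using w A1_le L_ge[OF u] M L unfolding e1_def[symmetric] e2_def[symmetric]
        by (intro add_mono mult_mono) auto
      also have "\<dots> = (M + L * M * CA) * \<bar>A0\<bar>" by (simp add: algebra_simps)
      finally have "\<bar>p - u n powr a\<bar> / \<bar>A0\<bar> \<le> D"
        using nz m by (simp add: D_def field_simps)
      then have "\<bar>q (s n) (u n)\<bar> \<le> D"
        by (simp add: q_def p_def A0_def)
      then show False using big[of n] elim by auto
    qed
    then show False by simp
  qed
  then obtain n where "\<forall>t\<ge>max (real n) 1. \<forall>x\<in>{1..K}. \<bar>q t x\<bar> \<le> real n + 1" by auto
  then show ?thesis unfolding q_def
    by (intro that[of "real n + 1" "max (real n) 1"]) simp_all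
qed

end

section \<open>Telescoping along doublings\<close>

lemma dyadic_decomposition:
  fixes t T :: real
  assumes "0 < T" "T \<le> t"
  obtains n s where "s \<in> {T..2*T}" "t = 2^n * s"
proof -
  obtain k where "t / T < 2 ^ k" using real_arch_pow[of 2 "t / T"] by auto
  then have ex: "\<exists>k. t < 2 ^ Suc k * T"
    using assms by (intro exI[of _ k]) (simp add: field_simps)
  define n where "n = (LEAST k. t < 2 ^ Suc k * T)"
  have up: "t < 2 ^ Suc n * T" unfolding n_def by (rule LeastI_ex[OF ex])
  have low: "2 ^ n * T \<le> t"
  proof (cases n)
    case 0
    then show ?thesis using assms by simp
  next
    case (Suc m)
    then have "\<not> t < 2 ^ Suc m * T"
      using not_less_Least[of m "\<lambda>k. t < 2 ^ Suc k * T"] by (simp add: n_def)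
    then show ?thesis using Suc by simp
  qed
  show ?thesis
    using up low by (intro that[of "t / 2^n" n]) (auto simp: field_simps)
qed

text \<open>\<open>B\<close> gains at least a factor p' > 1 per doubling, so the accumulated
  increments of \<open>D\<close> form a geometric sum dominated by its last term, and the starting
  value of \<open>D\<close> is negligible against \<open>B\<close>. The assumption
  \<open>bounds\<close> makes this uniform over the starting points in [T, 2T], from which every
  large t is reached by doublings.\<close>

lemma forward_contraction:
  fixes D B :: "real \<Rightarrow> real"
  assumes incr: "((\<lambda>t. (D (2 * t) - D t) / B t) \<longlongrightarrow> 0) at_top"
    and ratio: "((\<lambda>t. B (2 * t) / B t) \<longlongrightarrow> p) at_top" and p: "p > 1"
    and nz: "\<forall>\<^sub>F t in at_top. B t \<noteq> 0"
    and bounds: "\<forall>\<^sub>F T in at_top. \<exists>M m. m > 0 \<and> (\<forall>s\<in>{T..2*T}. \<bar>D s\<bar> \<le> M \<and> m \<le> \<bar>B s\<bar>)"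
  shows "((\<lambda>t. D t / B t) \<longlongrightarrow> 0) at_top"
proof (rule tendstoI)
  fix \<epsilon> :: real assume \<epsilon>: "\<epsilon> > 0"
  define p' where "p' = (1 + p) / 2"
  have p': "1 < p'" "p' < p" using p by (auto simp: p'_def)
  define \<delta> where "\<delta> = \<epsilon> * (p' - 1) / 2"
  have \<delta>: "\<delta> > 0" using \<epsilon> p' by (simp add: \<delta>_def)
  have "\<forall>\<^sub>F t in at_top. dist ((D (2 * t) - D t) / B t) 0 < \<delta>"
    using incr \<delta> by (rule tendstoD)
  moreover have "\<forall>\<^sub>F t in at_top. B (2 * t) / B t > p'"
    using ratio p' by (intro order_tendstoD(1)[of _ p])
  ultimately have "\<forall>\<^sub>F t in at_top. \<bar>D (2 * t) - D t\<bar> \<le> \<delta> * \<bar>B t\<bar> \<and> p' * \<bar>B t\<bar> \<le> \<bar>B (2 * t)\<bar>"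
    using nz
  proof eventually_elim
    case (elim t)
    have "p' \<le> \<bar>B (2 * t)\<bar> / \<bar>B t\<bar>" using elim abs_ge_self[of "B (2 * t) / B t"] by simp
    then show ?case using elim by (simp add: pos_le_divide_eq pos_divide_less_eq)
  qed
  then obtain T0 where T0: "\<And>t. t \<ge> T0 \<Longrightarrow> \<bar>D (2 * t) - D t\<bar> \<le> \<delta> * \<bar>B t\<bar> \<and> p' * \<bar>B t\<bar> \<le> \<bar>B (2 * t)\<bar>"
    by (auto simp: eventually_at_top_linorder)
  have "\<forall>\<^sub>F T in at_top. T \<ge> max T0 1 \<and> (\<exists>M m. m > 0 \<and> (\<forall>s\<in>{T..2*T}. \<bar>D s\<bar> \<le> M \<and> m \<le> \<bar>B s\<bar>))"
    using bounds eventually_ge_at_top by (rule eventually_conj[rotated])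
  then have "\<exists>T. T \<ge> max T0 1 \<and> (\<exists>M m. m > 0 \<and> (\<forall>s\<in>{T..2*T}. \<bar>D s\<bar> \<le> M \<and> m \<le> \<bar>B s\<bar>))"
    by (rule eventually_happens'[rotated]) simp
  then obtain T M m where "T \<ge> max T0 1" and m: "m > 0"
    and Mm: "\<And>s. s \<in> {T..2*T} \<Longrightarrow> \<bar>D s\<bar> \<le> M \<and> m \<le> \<bar>B s\<bar>"
    by blast
  then have T: "T \<ge> T0" "T \<ge> 1" by auto
  have M: "M \<ge> 0" using Mm[of T] T by auto
  have step: "p' ^ n * m \<le> \<bar>B (2^n * s)\<bar> \<and> \<bar>D (2^n * s)\<bar> \<le> M + \<delta> / (p' - 1) * \<bar>B (2^n * s)\<bar>"
    if s: "s \<in> {T..2*T}" for n s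
  proof (induction n)
    case 0
    have "0 \<le> \<delta> / (p' - 1) * \<bar>B s\<bar>" using \<delta> p' by simp
    then show ?case using Mm[OF s] by simp
  next
    case (Suc n)
    define t where "t = 2^n * s"
    have "1 * T \<le> 2^n * s" using s T by (intro mult_mono) auto
    then have t: "t \<ge> T0" using T by (simp add: t_def)
    have ih: "p' ^ n * m \<le> \<bar>B t\<bar>" "\<bar>D t\<bar> \<le> M + \<delta> / (p' - 1) * \<bar>B t\<bar>"
      using Suc by (auto simp: t_def)
    have "p' * (p' ^ n * m) \<le> p' * \<bar>B t\<bar>" using ih p' by (intro mult_left_mono) auto
    then have B: "p' ^ Suc n * m \<le> \<bar>B (2 * t)\<bar>" using T0[OF t] by (simp add: mult.assoc)
    have "\<bar>D (2 * t)\<bar> \<le> \<bar>D t\<bar> + \<delta> * \<bar>B t\<bar>" using T0[OF t] by linarith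
    also have "\<dots> \<le> M + \<delta> / (p' - 1) * \<bar>B t\<bar> + \<delta> * \<bar>B t\<bar>" using ih by simp
    also have "\<dots> = M + \<delta> / (p' - 1) * (p' * \<bar>B t\<bar>)"
      using p' by (simp add: field_simps)
    also have "\<dots> \<le> M + \<delta> / (p' - 1) * \<bar>B (2 * t)\<bar>"
      using T0[OF t] \<delta> p' by (intro add_mono mult_left_mono) auto
    finally show ?case using B by (simp add: t_def mult.assoc)
  qed
  \<comment> \<open>After \<open>N\<close> doublings |B| exceeds 2M/\<epsilon>, so the starting
    value \<open>M\<close> costs less than half of \<epsilon> |B|. Any t \<ge> 2^N (2T) has
    undergone at least \<open>N\<close> doublings, because its starting point is at most 2T.\<close>
  obtain N where N: "2 * M / (\<epsilon> * m) < p' ^ N" using real_arch_pow[OF p'(1)] by blast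
  have "\<forall>\<^sub>F t in at_top. t \<ge> 2 ^ N * (2 * T)" by (rule eventually_ge_at_top)
  then show "\<forall>\<^sub>F t in at_top. dist (D t / B t) 0 < \<epsilon>"
  proof eventually_elim
    case (elim t)
    have "1 * T \<le> 2 ^ N * (2 * T)" using T by (intro mult_mono) auto
    then have "T \<le> t" using elim by simp
    moreover have "0 < T" using T by simp
    ultimately obtain n s where s: "s \<in> {T..2*T}" and t: "t = 2^n * s"
      by (metis dyadic_decomposition)
    have "2 ^ N * (2 * T) \<le> 2 ^ n * (2 * T)"
      using elim s unfolding t by (elim order_trans) (intro mult_left_mono; simp)
    then have "N \<le> n" using T by simp
    then have "p' ^ N \<le> p' ^ n" using p' by (intro power_increasing) auto
    then have "2 * M / (\<epsilon> * m) < p' ^ n" using N by simp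
    then have "2 * M < \<epsilon> * (p' ^ n * m)" using \<epsilon> m by (simp add: field_simps)
    also have "\<dots> \<le> \<epsilon> * \<bar>B t\<bar>" using step[OF s, of n] \<epsilon> t by (intro mult_left_mono) auto
    finally have M_small: "2 * M < \<epsilon> * \<bar>B t\<bar>" .
    then have Bt: "\<bar>B t\<bar> > 0" using M by (cases "B t = 0") auto
    have "\<bar>D t\<bar> \<le> M + \<delta> / (p' - 1) * \<bar>B t\<bar>" using step[OF s, of n] t by simp
    also have "\<delta> / (p' - 1) = \<epsilon> / 2" using p' by (simp add: \<delta>_def field_simps)
    finally have "\<bar>D t\<bar> < \<epsilon> * \<bar>B t\<bar>" using M_small by simp
    then show ?case using Bt by (simp add: pos_divide_less_eq)
  qed
qed

text \<open>Here \<open>B\<close> decays, so the telescoping runs from infinity down: the increments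
  beyond t sum to a small multiple of |B t|, and \<open>null\<close> supplies the end value. The
  number of doublings tends to infinity for each fixed t, hence the pointwise form of
  \<open>null\<close>.\<close>

lemma backward_contraction:
  fixes D B :: "real \<Rightarrow> real"
  assumes incr: "((\<lambda>t. (D (2 * t) - D t) / B t) \<longlongrightarrow> 0) at_top"
    and ratio: "((\<lambda>t. B (2 * t) / B t) \<longlongrightarrow> q) at_top" and q: "0 < q" "q < 1"
    and nz: "\<forall>\<^sub>F t in at_top. B t \<noteq> 0"
    and null: "\<forall>\<^sub>F t in at_top. (\<lambda>n. D (2^n * t)) \<longlonglongrightarrow> 0"
  shows "((\<lambda>t. D t / B t) \<longlongrightarrow> 0) at_top"
proof (rule tendstoI)
  fix \<epsilon> :: real assume \<epsilon>: "\<epsilon> > 0"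
  define q' where "q' = (1 + q) / 2"
  have q': "0 < q'" "q < q'" "q' < 1" using q by (auto simp: q'_def)
  \<comment> \<open>Makes \<epsilon>/2 the fixed point of c = \<delta> + q' c, the recursion for the
    constant in front of |B t|.\<close>
  define \<delta> where "\<delta> = \<epsilon> * (1 - q') / 2"
  have \<delta>: "\<delta> > 0" using \<epsilon> q' by (simp add: \<delta>_def)
  have "\<forall>\<^sub>F t in at_top. dist ((D (2 * t) - D t) / B t) 0 < \<delta>"
    using incr \<delta> by (rule tendstoD)
  moreover have "\<forall>\<^sub>F t in at_top. \<bar>B (2 * t) / B t\<bar> < q'"
    using tendsto_rabs[OF ratio] q q' by (intro order_tendstoD(2)[of _ "\<bar>q\<bar>"]) auto
  ultimately have "\<forall>\<^sub>F t in at_top. \<bar>D (2 * t) - D t\<bar> \<le> \<delta> * \<bar>B t\<bar> \<and> \<bar>B (2 * t)\<bar> \<le> q' * \<bar>B t\<bar>"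
    using nz
  proof eventually_elim
    case (elim t)
    then show ?case by (simp add: pos_divide_less_eq)
  qed
  then obtain T0 where T0: "\<And>t. t \<ge> T0 \<Longrightarrow> \<bar>D (2 * t) - D t\<bar> \<le> \<delta> * \<bar>B t\<bar> \<and> \<bar>B (2 * t)\<bar> \<le> q' * \<bar>B t\<bar>"
    by (auto simp: eventually_at_top_linorder)
  have step: "\<bar>D t\<bar> \<le> \<bar>D (2^n * t)\<bar> + \<epsilon> / 2 * \<bar>B t\<bar>" if "t \<ge> max T0 0" for n t
    using that
  proof (induction n arbitrary: t)
    case 0
    then show ?case using \<epsilon> by simp
  next
    case (Suc n)
    have "\<bar>D t\<bar> \<le> \<bar>D (2 * t)\<bar> + \<delta> * \<bar>B t\<bar>" using T0[of t] Suc.prems by auto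
    also have "\<bar>D (2 * t)\<bar> \<le> \<bar>D (2^n * (2 * t))\<bar> + \<epsilon> / 2 * \<bar>B (2 * t)\<bar>"
      using Suc.prems by (intro Suc.IH) auto
    also have "\<epsilon> / 2 * \<bar>B (2 * t)\<bar> \<le> \<epsilon> / 2 * (q' * \<bar>B t\<bar>)"
      using T0[of t] Suc.prems \<epsilon> by (intro mult_left_mono) auto
    finally show ?case by (simp add: \<delta>_def field_simps)
  qed
  show "\<forall>\<^sub>F t in at_top. dist (D t / B t) 0 < \<epsilon>"
    using null nz eventually_ge_at_top[of "max T0 0"]
  proof eventually_elim
    case (elim t)
    have "(\<lambda>n. \<bar>D (2^n * t)\<bar> + \<epsilon> / 2 * \<bar>B t\<bar>) \<longlonglongrightarrow> \<bar>0\<bar> + \<epsilon> / 2 * \<bar>B t\<bar>"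
      using elim by (intro tendsto_intros)
    then have "\<bar>D t\<bar> \<le> \<bar>0\<bar> + \<epsilon> / 2 * \<bar>B t\<bar>"
      by (rule LIMSEQ_le_const) (use step[OF elim(3)] in auto)
    also have "\<dots> < \<epsilon> * \<bar>B t\<bar>" using elim \<epsilon> by simp
    finally show ?case using elim by (simp add: pos_divide_less_eq)
  qed
qed

lemma geometric_null:
  fixes f :: "real \<Rightarrow> real"
  assumes "((\<lambda>t. f (2 * t) / f t) \<longlongrightarrow> q) at_top" "\<bar>q\<bar> < 1" "\<forall>\<^sub>F t in at_top. f t \<noteq> 0"
  shows "\<forall>\<^sub>F t in at_top. (\<lambda>n. f (2^n * t)) \<longlonglongrightarrow> 0"
proof -
  obtain q' where q': "\<bar>q\<bar> < q'" "q' < 1" using dense assms by blast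
  have "\<forall>\<^sub>F t in at_top. \<bar>f (2 * t) / f t\<bar> < q'"
    using tendsto_rabs[OF assms(1)] q' by (intro order_tendstoD(2)[of _ "\<bar>q\<bar>"]) auto
  with assms(3) have "\<forall>\<^sub>F t in at_top. \<bar>f (2 * t)\<bar> \<le> q' * \<bar>f t\<bar>"
    by eventually_elim (simp add: pos_divide_less_eq)
  then obtain T where T: "\<And>t. t \<ge> T \<Longrightarrow> \<bar>f (2 * t)\<bar> \<le> q' * \<bar>f t\<bar>"
    by (auto simp: eventually_at_top_linorder)
  show ?thesis
    using eventually_ge_at_top[of "max T 0"]
  proof eventually_elim
    case (elim t)
    have bound: "\<bar>f (2^n * t)\<bar> \<le> q' ^ n * \<bar>f t\<bar>" for n
    proof (induction n)
      case (Suc n)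
      have "1 * t \<le> 2^n * t" using elim by (intro mult_right_mono) auto
      then have "\<bar>f (2 * (2^n * t))\<bar> \<le> q' * \<bar>f (2^n * t)\<bar>" using elim by (intro T) auto
      also have "\<dots> \<le> q' * (q' ^ n * \<bar>f t\<bar>)" using Suc q' by (intro mult_left_mono) auto
      finally show ?case by (simp add: mult.assoc)
    qed simp
    have "(\<lambda>n. q' ^ n * \<bar>f t\<bar>) \<longlonglongrightarrow> 0 * \<bar>f t\<bar>"
      using q' by (intro tendsto_intros LIMSEQ_realpow_zero) auto
    then show ?case
      by (intro Lim_null_comparison[of "\<lambda>n. f (2^n * t)" "\<lambda>n. q' ^ n * \<bar>f t\<bar>"]) (use bound in auto)
  qed
qed

section \<open>From the second-order relation to the integrals\<close>

context null_RV
begin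

text \<open>Substitute s = tu and f(tu) = f(t) (u^a + A(t) q(t, u)). The main terms f(t) (2^a - 1)/a
  of the integral and of the difference (f(2t) - f(t))/a cancel; what is left, divided by f(t) A(t),
  is \<open>W t - q t 2 / a\<close>. Its limit follows by dominated convergence, the uniform bound
  on \<open>q\<close> giving the majorant.\<close>

lemma doubling_increment:
  fixes f :: "real \<Rightarrow> real"
  assumes f_borel [measurable]: "f \<in> borel_measurable borel"
    and f_nz: "\<forall>\<^sub>F t in at_top. f t \<noteq> 0"
    and lim: "\<And>x. x \<ge> 1 \<Longrightarrow>
      ((\<lambda>t. (f (t * x) / f t - x powr a) / A t) \<longlongrightarrow> x powr a * power_kernel \<rho> x) at_top"
    and a: "a \<noteq> 0" "a + \<rho> \<noteq> 0"
  shows "((\<lambda>t. ((LINT s:{t..t*2}|lborel. f s / s) - (f (t * 2) - f t) / a) / (f t * A t))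
      \<longlongrightarrow> - (2 powr (a + \<rho>) - 1) / (a * (a + \<rho>))) at_top"
proof -
  define q where "q t x = (f (t * x) / f t - x powr a) / A t" for t x
  have [measurable]: "q t \<in> borel_measurable borel" for t
    unfolding q_def by measurable
  obtain C T where "C > 0" and T: "T > 0" and C: "\<And>t x. t \<ge> T \<Longrightarrow> x \<in> {1..2} \<Longrightarrow> \<bar>q t x\<bar> \<le> C"
    using second_order_locally_bounded[OF f_borel f_nz lim, of 2] unfolding q_def by auto
  define W where "W t = (LINT u|lborel. indicator {1..2} u * (q t u / u))" for t
  have bound: "\<bar>indicator {1..2} u * (q t u / u)\<bar> \<le> indicator {1..2} u * C" if "t \<ge> T" for t u
  proof (cases "u \<in> {1..2}")
    case True
    have "\<bar>q t u\<bar> / u \<le> C / 1"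
      using C[OF that True] True by (intro frac_le) auto
    then show ?thesis using True by simp
  qed simp
  have int_C: "integrable lborel (\<lambda>u. indicator {1..2::real} u * C)" by simp
  have W_lim: "(W \<longlongrightarrow> (LINT u|lborel. indicator {1..2} u * (u powr a * power_kernel \<rho> u / u))) at_top"
    unfolding W_def
  proof (rule integral_dominated_convergence_at_top[OF _ _ int_C])
    show "AE u in lborel. ((\<lambda>t. indicator {1..2} u * (q t u / u))
        \<longlongrightarrow> indicator {1..2} u * (u powr a * power_kernel \<rho> u / u)) at_top"
    proof (intro AE_I2)
      fix u :: real
      show "((\<lambda>t. indicator {1..2} u * (q t u / u))
        \<longlongrightarrow> indicator {1..2} u * (u powr a * power_kernel \<rho> u / u)) at_top"
      proof (cases "u \<in> {1..2}")
        case True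
        then show ?thesis using lim[of u] unfolding q_def
          by (intro tendsto_intros) auto
      qed simp
    qed
    show "\<forall>\<^sub>F t in at_top. AE u in lborel. norm (indicator {1..2} u * (q t u / u)) \<le> indicator {1..2} u * C"
      using eventually_ge_at_top[of T] by eventually_elim (simp only: real_norm_def bound, simp)
  qed measurable
  \<comment> \<open>An antiderivative of u^(a-1) k(u), found by parts. Its first term at 2 is the
    limit of \<open>q t 2 / a\<close>, so only the pure power survives in the final limit.\<close>
  define \<Phi> where "\<Phi> u = u powr a * power_kernel \<rho> u / a - u powr (a + \<rho>) / (a * (a + \<rho>))" for u
  have deriv: "(\<Phi> has_real_derivative u powr a * power_kernel \<rho> u / u) (at u)" if "u > 0" for u
  proof -
    have "(\<Phi> has_real_derivative (a * u powr (a - 1) * power_kernel \<rho> u + u powr a * u powr (\<rho> - 1)) / a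
        - (a + \<rho>) * u powr (a + \<rho> - 1) / (a * (a + \<rho>))) (at u)"
      unfolding \<Phi>_def using that a
      by (auto intro!: derivative_eq_intros power_kernel_has_derivative)
    also have "(a + \<rho>) * u powr (a + \<rho> - 1) / (a * (a + \<rho>)) = u powr a * u powr (\<rho> - 1) / a"
      using a by (simp add: powr_add[symmetric] add_diff_eq)
    also have "(a * u powr (a - 1) * power_kernel \<rho> u + u powr a * u powr (\<rho> - 1)) / a
        - u powr a * u powr (\<rho> - 1) / a = u powr (a - 1) * power_kernel \<rho> u"
      using a by (simp add: add_divide_distrib)
    also have "\<dots> = u powr a * power_kernel \<rho> u / u"
      using that by (simp add: powr_diff)
    finally show ?thesis .
  qed
  have "(LINT u|lborel. indicator {1..2} u *\<^sub>R (u powr a * power_kernel \<rho> u / u)) = \<Phi> 2 - \<Phi> 1"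
  proof (rule integral_FTC_atLeastAtMost)
    show "(\<Phi> has_vector_derivative u powr a * power_kernel \<rho> u / u) (at u within {1..2})"
      if "1 \<le> u" "u \<le> 2" for u
      using deriv[of u] that
      by (auto simp: has_real_derivative_iff_has_vector_derivative[symmetric] intro: has_field_derivative_at_within)
    show "continuous_on {1..2} (\<lambda>u. u powr a * power_kernel \<rho> u / u)"
      by (intro continuous_intros continuous_on_power_kernel) auto
  qed simp
  then have \<Phi>: "(LINT u|lborel. indicator {1..2} u * (u powr a * power_kernel \<rho> u / u)) = \<Phi> 2 - \<Phi> 1"
    by simp
  have "((\<lambda>t. W t - q t 2 / a) \<longlongrightarrow> (\<Phi> 2 - \<Phi> 1) - 2 powr a * power_kernel \<rho> 2 / a) at_top"
    using lim[of 2] a unfolding \<Phi>[symmetric] q_def[abs_def] by (intro tendsto_intros W_lim) auto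
  also have "(\<Phi> 2 - \<Phi> 1) - 2 powr a * power_kernel \<rho> 2 / a = - (2 powr (a + \<rho>) - 1) / (a * (a + \<rho>))"
    using a by (simp add: \<Phi>_def power_kernel_def diff_divide_distrib)
  finally have main: "((\<lambda>t. W t - q t 2 / a) \<longlongrightarrow> - (2 powr (a + \<rho>) - 1) / (a * (a + \<rho>))) at_top" .
  have pow: "(LINT u|lborel. indicator {1..2} u * (u powr a / u)) = (2 powr a - 1) / a"
    "integrable lborel (\<lambda>u. indicator {1..2::real} u * (u powr a / u))"
  proof -
    have "(LINT u|lborel. indicator {1..2} u *\<^sub>R (u powr a / u)) = 2 powr a / a - 1 powr a / a"
    proof (rule integral_FTC_atLeastAtMost)
      show "((\<lambda>u. u powr a / a) has_vector_derivative u powr a / u) (at u within {1..2})"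
        if "1 \<le> u" "u \<le> 2" for u
        unfolding has_real_derivative_iff_has_vector_derivative[symmetric]
        using that a by (auto intro!: derivative_eq_intros simp: powr_diff)
      show "continuous_on {1..2::real} (\<lambda>u. u powr a / u)"
        by (intro continuous_intros) auto
    qed simp
    then show "(LINT u|lborel. indicator {1..2} u * (u powr a / u)) = (2 powr a - 1) / a"
      by (simp add: diff_divide_distrib)
    have "set_integrable lborel {1..2::real} (\<lambda>u. u powr a / u)"
      by (intro borel_integrable_atLeastAtMost' continuous_intros) auto
    then show "integrable lborel (\<lambda>u. indicator {1..2::real} u * (u powr a / u))"
      by (simp add: set_integrable_def)
  qed
  have "\<forall>\<^sub>F t in at_top. W t - q t 2 / a =
      ((LINT s:{t..t*2}|lborel. f s / s) - (f (t * 2) - f t) / a) / (f t * A t)"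
    using A_nonzero f_nz eventually_ge_at_top[of T]
  proof eventually_elim
    case (elim t)
    have t: "t > 0" using elim T by simp
    have int_q: "integrable lborel (\<lambda>u. indicator {1..2} u * (q t u / u))"
      by (rule Bochner_Integration.integrable_bound[OF int_C])
        (measurable, intro AE_I2, simp only: real_norm_def, rule order_trans[OF bound[OF elim(3)] abs_ge_self])
    have lin: "(LINT u|lborel. c * g u + d * h u) = c * integral\<^sup>L lborel g + d * integral\<^sup>L lborel h"
      if "integrable lborel g" "integrable lborel h" for c d and g h :: "real \<Rightarrow> real"
      using that by simp
    have f_eq: "f (t * u) = f t * (u powr a + A t * q t u)" for u
      using elim by (simp add: q_def field_simps)
    have "(LINT s:{t..t*2}|lborel. f s / s)
        = \<bar>t\<bar> *\<^sub>R (LINT u|lborel. indicator {t..t*2} (0 + t * u) *\<^sub>R (f (0 + t * u) / (0 + t * u)))"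
      unfolding set_lebesgue_integral_def using t by (intro lborel_integral_real_affine) simp
    also have "(\<lambda>u. indicator {t..t*2} (0 + t * u) *\<^sub>R (f (0 + t * u) / (0 + t * u)))
        = (\<lambda>u. f t / t * (indicator {1..2} u * (u powr a / u)) + f t * A t / t * (indicator {1..2} u * (q t u / u)))"
    proof
      fix u :: real
      have "indicator {t..t*2} (t * u) = (indicator {1..2} u :: real)"
        using t by (auto simp: indicator_def)
      then show "indicator {t..t*2} (0 + t * u) *\<^sub>R (f (0 + t * u) / (0 + t * u))
        = f t / t * (indicator {1..2} u * (u powr a / u)) + f t * A t / t * (indicator {1..2} u * (q t u / u))"
        using t by (cases "u \<in> {1..2}") (simp_all add: f_eq field_simps)
    qed
    also have "\<bar>t\<bar> *\<^sub>R (LINT u|lborel. f t / t * (indicator {1..2} u * (u powr a / u))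
          + f t * A t / t * (indicator {1..2} u * (q t u / u)))
        = f t * ((2 powr a - 1) / a) + f t * A t * W t"
      unfolding lin[OF pow(2) int_q] W_def[symmetric] pow(1) using t a by (simp add: field_simps)
    finally have L: "(LINT s:{t..t*2}|lborel. f s / s) = f t * ((2 powr a - 1) / a) + f t * A t * W t" .
    show ?case unfolding L f_eq using elim a by (simp add: field_simps)
  qed
  with main show ?thesis by (rule Lim_transform_eventually)
qed

end

context null_RV
begin

text \<open>\<open>H\<close> enters only through its increments, which leaves a constant of
  integration free. When a + \<rho> > 0 the function \<open>B\<close> outgrows it; when a + \<rho> <
  0 it is fixed by requiring H -> 0 along doublings. In either case 2^(a+\<rho>) differs from 1,
  which gives the geometric behaviour needed for telescoping.\<close>

lemma karamata_direct:
  fixes f H :: "real \<Rightarrow> real"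
  assumes f_borel [measurable]: "f \<in> borel_measurable borel"
    and f_pos: "\<forall>\<^sub>F t in at_top. f t > 0"
    and lim: "\<And>x. x \<ge> 1 \<Longrightarrow>
      ((\<lambda>t. (f (t * x) / f t - x powr a) / A t) \<longlongrightarrow> x powr a * power_kernel \<rho> x) at_top"
    and H: "\<forall>\<^sub>F t in at_top. \<forall>x\<ge>1. H (t * x) - H t = (LINT s:{t..t*x}|lborel. f s / s)"
    and sign: "a > 0 \<and> a + \<rho> > 0 \<or>
      a < 0 \<and> a + \<rho> < 0 \<and> (\<forall>\<^sub>F t in at_top. (\<lambda>n. H (2^n * t)) \<longlonglongrightarrow> 0)"
  shows "((\<lambda>t. (f t / H t - a) / A t) \<longlongrightarrow> a / (a + \<rho>)) at_top"
proof -
  have a: "a \<noteq> 0" "a + \<rho> \<noteq> 0" using sign by auto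
  have f_nz: "\<forall>\<^sub>F t in at_top. f t \<noteq> 0" using f_pos by eventually_elim simp
  define B where "B t = f t * A t" for t
  have B_borel [measurable]: "B \<in> borel_measurable borel" unfolding B_def by measurable
  have B_nz: "\<forall>\<^sub>F t in at_top. B t \<noteq> 0"
    using f_nz A_nonzero by eventually_elim (simp add: B_def)
  have f_ratio: "((\<lambda>t. f (t * x) / f t) \<longlongrightarrow> x powr a) at_top" if "x \<ge> 1" for x
    using ratio_of_second_order[OF lim[OF that]] .
  have B_ratio: "((\<lambda>t. B (t * x) / B t) \<longlongrightarrow> x powr (a + \<rho>)) at_top" if "x \<ge> 1" for x
  proof -
    have "((\<lambda>t. (f (t * x) / f t) * (A (t * x) / A t)) \<longlongrightarrow> x powr a * x powr \<rho>) at_top"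
      using that by (intro tendsto_intros f_ratio A_ratio) auto
    then show ?thesis by (simp add: B_def powr_add)
  qed
  have B_inv_ratio: "((\<lambda>t. inverse (B (t * x)) / inverse (B t)) \<longlongrightarrow> x powr (- (a + \<rho>))) at_top"
    if "x \<ge> 1" for x
  proof -
    have "((\<lambda>t. inverse (B (t * x) / B t)) \<longlongrightarrow> inverse (x powr (a + \<rho>))) at_top"
      using that by (intro tendsto_intros B_ratio) auto
    then show ?thesis unfolding powr_minus by (simp add: divide_inverse mult.commute)
  qed
  define L where "L = - 1 / (a * (a + \<rho>))"
  define D where "D t = H t - f t / a - L * B t" for t
  have incr: "((\<lambda>t. (D (2 * t) - D t) / B t) \<longlongrightarrow> 0) at_top"
  proof -
    have "((\<lambda>t. ((LINT s:{t..t*2}|lborel. f s / s) - (f (t * 2) - f t) / a) / (f t * A t)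
        - L * (B (t * 2) / B t - 1)) \<longlongrightarrow> - (2 powr (a + \<rho>) - 1) / (a * (a + \<rho>)) - L * (2 powr (a + \<rho>) - 1)) at_top"
      by (intro tendsto_intros doubling_increment[OF f_borel f_nz lim a] B_ratio) auto
    also have "- (2 powr (a + \<rho>) - 1) / (a * (a + \<rho>)) - L * (2 powr (a + \<rho>) - 1) = 0"
      by (simp add: L_def add_divide_distrib[symmetric])
    finally show ?thesis
    proof (rule Lim_transform_eventually)
      show "\<forall>\<^sub>F t in at_top. ((LINT s:{t..t*2}|lborel. f s / s) - (f (t * 2) - f t) / a) / (f t * A t)
          - L * (B (t * 2) / B t - 1) = (D (2 * t) - D t) / B t"
        using H B_nz
      proof eventually_elim
        case (elim t)
        have "(LINT s:{t..t*2}|lborel. f s / s) = H (t * 2) - H t" using elim(1) by simp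
        moreover have "f t * A t = B t" by (simp add: B_def)
        ultimately show ?case
          using elim(2) by (simp add: D_def diff_divide_distrib mult.commute[of 2] right_diff_distrib)
      qed
    qed
  qed
  have D_B: "((\<lambda>t. D t / B t) \<longlongrightarrow> 0) at_top"
    using sign
  proof
    assume pos: "a > 0 \<and> a + \<rho> > 0"
    obtain Cf Tf where Cf: "\<And>t x. t \<ge> Tf \<Longrightarrow> x \<in> {1..2} \<Longrightarrow> \<bar>f (t * x) / f t\<bar> \<le> Cf"
      using regular_variation_locally_bounded[OF f_borel f_nz f_ratio one_le_numeral] by metis
    obtain CB TB where CB: "\<And>t x. t \<ge> TB \<Longrightarrow> x \<in> {1..2} \<Longrightarrow> \<bar>B (t * x) / B t\<bar> \<le> CB"
      using regular_variation_locally_bounded[OF B_borel B_nz B_ratio one_le_numeral] by metis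
    have B_inv: "(\<lambda>t. inverse (B t)) \<in> borel_measurable borel" "\<forall>\<^sub>F t in at_top. inverse (B t) \<noteq> 0"
      using B_nz by auto
    \<comment> \<open>The local bound for 1/B is a lower bound for |B|: it gives |B s| \<ge> |B T| /
      CI on [T, 2T].\<close>
    obtain CI TI where CI: "CI > 0"
      "\<And>t x. t \<ge> TI \<Longrightarrow> x \<in> {1..2} \<Longrightarrow> \<bar>inverse (B (t * x)) / inverse (B t)\<bar> \<le> CI"
      using regular_variation_locally_bounded[OF B_inv B_inv_ratio one_le_numeral] by metis
    have f_pos_ge: "\<forall>\<^sub>F t in at_top. \<forall>s\<ge>t. f s > 0"
      "\<forall>\<^sub>F t in at_top. \<forall>s\<ge>t. B s \<noteq> 0"
      "\<forall>\<^sub>F t in at_top. \<forall>s\<ge>t. \<forall>x\<ge>1. H (s * x) - H s = (LINT u:{s..s*x}|lborel. f u / u)"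
      using f_pos B_nz H by (auto intro: eventually_all_ge_at_top)
    have ge: "\<forall>\<^sub>F T in at_top. T \<ge> max (max Tf TB) (max TI 1)" by (rule eventually_ge_at_top)
    have "\<forall>\<^sub>F T in at_top. \<exists>M m. m > 0 \<and> (\<forall>s\<in>{T..2*T}. \<bar>D s\<bar> \<le> M \<and> m \<le> \<bar>B s\<bar>)"
      using f_pos_ge ge
    proof eventually_elim
      case (elim T)
      have T: "T > 0" "T \<ge> Tf" "T \<ge> TB" "T \<ge> TI" using elim by auto
      \<comment> \<open>\<open>f\<close> and \<open>B\<close> are controlled by their local bounds.
        For \<open>H\<close> monotonicity is enough: the integrand is positive, so the values of
        \<open>H\<close> on [T, 2T] lie between \<open>H T\<close> and
        \<open>H (T * 2)\<close>.\<close>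
      define M where "M = \<bar>H T\<bar> + \<bar>H (T * 2)\<bar> + Cf * f T / \<bar>a\<bar> + \<bar>L\<bar> * (CB * \<bar>B T\<bar>)"
      have nonneg: "0 \<le> (LINT u:{s..s*x}|lborel. f u / u)" if "s \<ge> T" for s x
        unfolding set_lebesgue_integral_def
      proof (intro integral_nonneg_AE AE_I2)
        fix u
        show "0 \<le> indicator {s..s*x} u *\<^sub>R (f u / u)"
        proof (cases "u \<in> {s..s*x}")
          case True
          then have "f u > 0" "u > 0" using elim(1) that T by auto
          then show ?thesis by (simp add: indicator_def)
        qed simp
      qed
      have "\<bar>D s\<bar> \<le> M \<and> \<bar>B T\<bar> / CI \<le> \<bar>B s\<bar>" if s: "s \<in> {T..2*T}" for s
      proof -
        define x where "x = s / T"
        have x: "x \<in> {1..2}" "s = T * x" using s T by (auto simp: x_def field_simps)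
        have "f T > 0" "f s > 0" using elim(1) s by auto
        then have fs: "\<bar>f s\<bar> \<le> Cf * f T"
          using Cf[OF T(2) x(1)] by (simp add: x(2) pos_divide_le_eq)
        have BT: "B T \<noteq> 0" "B s \<noteq> 0" using elim(2) s by auto
        have Bs: "\<bar>B s\<bar> \<le> CB * \<bar>B T\<bar>"
          using CB[OF T(3) x(1)] BT by (simp add: x(2) pos_divide_le_eq)
        have "\<bar>B T\<bar> \<le> CI * \<bar>B s\<bar>"
          using CI(2)[OF T(4) x(1)] BT unfolding x(2)[symmetric] by (simp add: abs_mult divide_simps)
        then have low: "\<bar>B T\<bar> / CI \<le> \<bar>B s\<bar>"
          using CI by (simp add: pos_divide_le_eq mult.commute)
        have "H (T * x) - H T = (LINT u:{T..T*x}|lborel. f u / u)"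
          using elim(3) x(1) by auto
        then have H1: "H T \<le> H s" using nonneg[of T x] x(2) by auto
        have "H (s * (2 / x)) - H s = (LINT u:{s..s*(2/x)}|lborel. f u / u)"
        proof -
          have "s \<ge> T" "2 / x \<ge> 1" using x(1) s by auto
          then show ?thesis using elim(3) by blast
        qed
        moreover have "s * (2 / x) = T * 2" using x by auto
        ultimately have "H s \<le> H (T * 2)" using nonneg[of s "2/x"] s by auto
        with H1 have Hs: "\<bar>H s\<bar> \<le> \<bar>H T\<bar> + \<bar>H (T * 2)\<bar>" by linarith
        have "\<bar>D s\<bar> \<le> \<bar>H s\<bar> + \<bar>f s / a\<bar> + \<bar>L * B s\<bar>" unfolding D_def by linarith
        also have "\<dots> \<le> M" unfolding M_def abs_mult abs_divide
          using Hs fs Bs by (intro add_mono mult_left_mono divide_right_mono) auto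
        finally show ?thesis using low by simp
      qed
      moreover have "\<bar>B T\<bar> / CI > 0" using elim(2) CI by auto
      ultimately show ?case by blast
    qed
    then show ?thesis
      using pos B_ratio[of 2] by (intro forward_contraction[OF incr _ _ B_nz]) (auto simp: mult.commute)
  next
    assume neg: "a < 0 \<and> a + \<rho> < 0 \<and> (\<forall>\<^sub>F t in at_top. (\<lambda>n. H (2^n * t)) \<longlonglongrightarrow> 0)"
    have lt1: "2 powr c < 1" if "c < 0" for c :: real
      using powr_less_mono[of c 0 2] that by simp
    have "\<forall>\<^sub>F t in at_top. (\<lambda>n. f (2^n * t)) \<longlonglongrightarrow> 0"
      using f_ratio[of 2] neg lt1[of a] by (intro geometric_null[OF _ _ f_nz, of "2 powr a"]) (auto simp: mult.commute)
    moreover have "\<forall>\<^sub>F t in at_top. (\<lambda>n. B (2^n * t)) \<longlonglongrightarrow> 0"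
      using B_ratio[of 2] neg lt1[of "a + \<rho>"]
      by (intro geometric_null[OF _ _ B_nz, of "2 powr (a + \<rho>)"]) (auto simp: mult.commute)
    moreover have "\<forall>\<^sub>F t in at_top. (\<lambda>n. H (2^n * t)) \<longlonglongrightarrow> 0" using neg by blast
    ultimately have "\<forall>\<^sub>F t in at_top. (\<lambda>n. D (2^n * t)) \<longlonglongrightarrow> 0"
    proof eventually_elim
      case (elim t)
      have "(\<lambda>n. H (2^n * t) - f (2^n * t) / a - L * B (2^n * t)) \<longlonglongrightarrow> 0 - 0 / a - L * 0"
        using elim a by (intro tendsto_intros)
      then show ?case by (simp add: D_def)
    qed
    then show ?thesis
      using neg lt1[of "a + \<rho>"] B_ratio[of 2]
      by (intro backward_contraction[OF incr _ _ _ B_nz, of "2 powr (a + \<rho>)"]) (auto simp: mult.commute)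
  qed
  \<comment> \<open>The term D/B + L equals (H - f/a)/(f A). Its convergence gives H/f -> 1/a, hence
    also that \<open>H\<close> does not vanish near infinity, before the second-order limit is
    formed.\<close>
  have "((\<lambda>t. A t * (D t / B t + L) + 1 / a) \<longlongrightarrow> 0 * (0 + L) + 1 / a) at_top"
    by (intro tendsto_intros A_null D_B)
  then have "((\<lambda>t. A t * (D t / B t + L) + 1 / a) \<longlongrightarrow> 1 / a) at_top" by simp
  moreover have "\<forall>\<^sub>F t in at_top. A t * (D t / B t + L) + 1 / a = H t / f t"
    using A_nonzero f_nz
    by eventually_elim (use a in \<open>simp add: D_def B_def field_simps\<close>)
  ultimately have "((\<lambda>t. H t / f t) \<longlongrightarrow> 1 / a) at_top" by (rule Lim_transform_eventually)
  then have H_f: "((\<lambda>t. H t / f t) \<longlongrightarrow> inverse a) at_top" by (simp add: inverse_eq_divide)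
  have "((\<lambda>t. inverse (H t / f t)) \<longlongrightarrow> inverse (inverse a)) at_top"
    by (rule tendsto_inverse[OF H_f]) (use a in simp)
  then have f_H: "((\<lambda>t. inverse (H t / f t)) \<longlongrightarrow> a) at_top"
    unfolding inverse_inverse_eq .
  have "\<forall>\<^sub>F t in at_top. H t / f t \<noteq> 0"
    by (rule tendsto_imp_eventually_ne[OF H_f]) (use a in simp)
  then have H_nz: "\<forall>\<^sub>F t in at_top. H t \<noteq> 0" by eventually_elim auto
  have "((\<lambda>t. - a * (D t / B t + L) * inverse (H t / f t)) \<longlongrightarrow> - a * (0 + L) * a) at_top"
    by (intro tendsto_intros D_B f_H)
  also have "- a * (0 + L) * a = a / (a + \<rho>)" using a by (simp add: L_def)
  finally show ?thesis
  proof (rule Lim_transform_eventually)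
    show "\<forall>\<^sub>F t in at_top. - a * (D t / B t + L) * inverse (H t / f t) = (f t / H t - a) / A t"
      using A_nonzero f_nz H_nz
    proof eventually_elim
      case (elim t)
      have D: "D t / B t + L = (H t - f t / a) / (f t * A t)"
        using elim by (simp add: D_def B_def field_simps)
      show ?case unfolding D using elim a by (simp add: field_simps)
    qed
  qed
qed

end

section \<open>From the integrals back: the Volterra equation\<close>

lemma set_integrable_continuous_mult:
  fixes g h :: "real \<Rightarrow> real"
  assumes h: "continuous_on {b..x} h" and g: "set_integrable lborel {b..x} g"
  shows "set_integrable lborel {b..x} (\<lambda>v. h v * g v)"
proof -
  have "bounded (h ` {b..x})"
    by (intro compact_imp_bounded compact_continuous_image h) simp
  then obtain M where M: "\<And>v. v \<in> {b..x} \<Longrightarrow> \<bar>h v\<bar> \<le> M"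
    unfolding bounded_iff real_norm_def by blast
  show ?thesis
  proof (rule set_integrable_bound)
    show "set_integrable lborel {b..x} (\<lambda>v. M * g v)" using g by simp
    have "(\<lambda>v. (indicator {b..x} v *\<^sub>R h v) * (indicator {b..x} v *\<^sub>R g v)) \<in> borel_measurable lborel"
      using g borel_integrable_atLeastAtMost'[OF h] unfolding set_integrable_def
      by (intro borel_measurable_times borel_measurable_integrable)
    also have "(\<lambda>v. (indicator {b..x} v *\<^sub>R h v) * (indicator {b..x} v *\<^sub>R g v))
        = (\<lambda>v. indicator {b..x} v *\<^sub>R (h v * g v))"
      by (rule ext) (simp add: indicator_def)
    finally show "set_borel_measurable lborel {b..x} (\<lambda>v. h v * g v)"
      by (simp add: set_borel_measurable_def)
    show "AE v in lborel. v \<in> {b..x} \<longrightarrow> norm (h v * g v) \<le> norm (M * g v)"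
    proof (intro AE_I2 impI)
      fix v assume "v \<in> {b..x}"
      from M[OF this] have "\<bar>h v\<bar> * \<bar>g v\<bar> \<le> \<bar>M\<bar> * \<bar>g v\<bar>"
        by (intro mult_right_mono) auto
      then show "norm (h v * g v) \<le> norm (M * g v)" by (simp add: abs_mult)
    qed
  qed
qed

text \<open>Fubini on the triangle b \<le> v \<le> u \<le> x. As \<open>g\<close> is merely
  integrable, its primitive need not be differentiable everywhere; the fundamental theorem is
  applied only to \<open>h\<close>, over [v, x].\<close>

lemma set_integral_primitive_by_parts:
  fixes g h h' :: "real \<Rightarrow> real"
  assumes xb: "b \<le> x" and g: "set_integrable lborel {b..x} g"
    and h: "\<And>u. u \<in> {b..x} \<Longrightarrow> (h has_real_derivative h' u) (at u within {b..x})"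
    and h': "continuous_on {b..x} h'"
  shows "(LINT u:{b..x}|lborel. h' u * (LINT v:{b..u}|lborel. g v))
      = h x * (LINT v:{b..x}|lborel. g v) - (LINT v:{b..x}|lborel. h v * g v)"
proof -
  define g0 where "g0 v = indicator {b..x} v * g v" for v
  define k where "k u = indicator {b..x} u * h' u" for u
  have g0 [measurable]: "integrable lborel g0" using g by (simp add: g0_def[abs_def] set_integrable_def)
  have "set_integrable lborel {b..x} h'" using h' by (rule borel_integrable_atLeastAtMost')
  then have k: "integrable lborel k" by (simp add: k_def[abs_def] set_integrable_def)
  have [measurable]: "g0 \<in> borel_measurable borel" "k \<in> borel_measurable borel"
    using borel_measurable_integrable[OF g0] borel_measurable_integrable[OF k] by auto
  define \<phi> where "\<phi> u v = (if v \<le> u then k u * g0 v else 0)" for u v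
  have [measurable]: "case_prod \<phi> \<in> borel_measurable (lborel \<Otimes>\<^sub>M lborel)"
    unfolding \<phi>_def by measurable
  have "integrable (lborel \<Otimes>\<^sub>M lborel) (\<lambda>(u, v). k u * g0 v)"
  proof (rule lborel_pair.Fubini_integrable)
    show "integrable lborel (\<lambda>u. LINT v|lborel. norm (case (u, v) of (u, v) \<Rightarrow> k u * g0 v))"
      using k g0 by (simp add: abs_mult)
    show "AE u in lborel. integrable lborel (\<lambda>v. case (u, v) of (u, v) \<Rightarrow> k u * g0 v)"
      using g0 by simp
  qed measurable
  then have \<phi>: "integrable (lborel \<Otimes>\<^sub>M lborel) (case_prod \<phi>)"
    by (rule Bochner_Integration.integrable_bound) (auto simp: \<phi>_def)
  have "(LINT u:{b..x}|lborel. h' u * (LINT v:{b..u}|lborel. g v)) = (LINT u|lborel. LINT v|lborel. \<phi> u v)"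
    unfolding set_lebesgue_integral_def
  proof (rule Bochner_Integration.integral_cong[OF refl])
    fix u :: real
    show "indicator {b..x} u *\<^sub>R (h' u * (LINT v|lborel. indicator {b..u} v *\<^sub>R g v)) = (LINT v|lborel. \<phi> u v)"
    proof (cases "u \<in> {b..x}")
      case True
      have "(LINT v|lborel. \<phi> u v) = (LINT v|lborel. k u * (indicator {b..u} v *\<^sub>R g v))"
        using True by (intro Bochner_Integration.integral_cong) (auto simp: \<phi>_def g0_def indicator_def)
      then show ?thesis using True by (simp add: k_def)
    next
      case False
      then have "\<phi> u = (\<lambda>v. 0)" by (auto simp: \<phi>_def k_def)
      with False show ?thesis by simp
    qed
  qed
  also have "\<dots> = (LINT v|lborel. LINT u|lborel. \<phi> u v)"
    using \<phi> by (rule lborel_pair.Fubini_integral[symmetric])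
  also have "\<dots> = (LINT v|lborel. h x * g0 v - h v * g0 v)"
  proof (rule Bochner_Integration.integral_cong[OF refl])
    fix v :: real
    show "(LINT u|lborel. \<phi> u v) = h x * g0 v - h v * g0 v"
    proof (cases "v \<in> {b..x}")
      case True
      have "(LINT u|lborel. \<phi> u v) = (LINT u|lborel. g0 v * (indicator {v..x} u *\<^sub>R h' u))"
        using True by (intro Bochner_Integration.integral_cong) (auto simp: \<phi>_def k_def indicator_def)
      also have "\<dots> = g0 v * (LINT u|lborel. indicator {v..x} u *\<^sub>R h' u)" by simp
      also have "(LINT u|lborel. indicator {v..x} u *\<^sub>R h' u) = h x - h v"
      proof (rule integral_FTC_atLeastAtMost)
        show "continuous_on {v..x} h'" using h' by (rule continuous_on_subset) (use True in auto)
        show "(h has_vector_derivative h' u) (at u within {v..x})" if "v \<le> u" "u \<le> x" for u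
        proof -
          have "(h has_real_derivative h' u) (at u within {v..x})"
            by (rule has_field_derivative_subset[OF h]) (use True that in auto)
          then show ?thesis by (simp only: has_real_derivative_iff_has_vector_derivative)
        qed
      qed (use True in auto)
      finally show ?thesis by (simp add: algebra_simps)
    next
      case False
      then have g0_v: "g0 v = 0" by (auto simp: g0_def)
      then have "(\<lambda>u. \<phi> u v) = (\<lambda>u. 0)" by (auto simp: \<phi>_def)
      with g0_v show ?thesis by simp
    qed
  qed
  also have "\<dots> = h x * (LINT v|lborel. g0 v) - (LINT v|lborel. h v * g0 v)"
  proof -
    have "continuous_on {b..x} h"
      using h by (intro DERIV_continuous_on)
    then have "set_integrable lborel {b..x} (\<lambda>v. h v * g v)"
      using g by (rule set_integrable_continuous_mult)
    then have "integrable lborel (\<lambda>v. h v * g0 v)"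
      by (simp add: set_integrable_def g0_def mult.left_commute)
    then show ?thesis using g0 by simp
  qed
  finally show ?thesis
    by (simp add: set_lebesgue_integral_def g0_def[abs_def] mult.left_commute)
qed

context null_RV
begin

text \<open>Near infinity \<open>e\<close> is small, so the Volterra operator on [1, K] is a
  contraction: this bounds y and then forces y -> 1. Both facts, put back into the equation, give
  the limit of (y - 1)/A(t). The limit \<open>c\<close> is arbitrary here; its particular value
  enters when the relation is transferred from \<open>H\<close> to the integrand.\<close>

lemma karamata_converse_ge1:
  fixes f H :: "real \<Rightarrow> real"
  assumes [measurable]: "f \<in> borel_measurable borel" "H \<in> borel_measurable borel"
    and H_nz: "\<forall>\<^sub>F t in at_top. H t \<noteq> 0"
    and H: "\<forall>\<^sub>F t in at_top. \<forall>x\<ge>1. set_integrable lborel {t..t*x} (\<lambda>s. f s / s) \<and>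
        H (t * x) - H t = (LINT s:{t..t*x}|lborel. f s / s)"
    and lim: "((\<lambda>t. (f t / H t - a) / A t) \<longlongrightarrow> c) at_top"
    and K: "K \<ge> 1"
  shows "((\<lambda>t. (H (t * K) / H t - K powr a) / A t) \<longlongrightarrow> c * (K powr a * power_kernel \<rho> K)) at_top"
proof -
  define e where "e t = f t / H t - a" for t
  define y where "y t u = u powr (- a) * (H (t * u) / H t)" for t u
  have [measurable]: "e \<in> borel_measurable borel" "y t \<in> borel_measurable borel" for t
    unfolding e_def y_def by measurable
  have e_null: "(e \<longlongrightarrow> 0) at_top"
    using ratio_of_second_order[OF lim] unfolding e_def by (intro LIM_zero)
  have nz_ge: "\<forall>\<^sub>F t in at_top. \<forall>s\<ge>t. H s \<noteq> 0 \<and> A s \<noteq> 0"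
    using H_nz A_nonzero by (intro eventually_all_ge_at_top eventually_conj)
  \<comment> \<open>Continuity of \<open>f\<close> is not available, so \<open>y\<close> is not differentiable; the equation is
    obtained from the integrated identity by parts.\<close>
  have volterra: "\<forall>\<^sub>F t in at_top. \<forall>x\<ge>1. set_integrable lborel {1..x} (\<lambda>u. y t u * e (t * u) / u) \<and>
      y t x = 1 + (LINT u:{1..x}|lborel. y t u * e (t * u) / u) \<and> bdd_above ((\<lambda>u. \<bar>y t u\<bar>) ` {1..x})"
    using nz_ge H eventually_gt_at_top[of 0]
  proof eventually_elim
    case (elim t)
    have Ht: "H t \<noteq> 0" "t > 0" using elim by auto
    show ?case
    proof (intro allI impI)
      fix x :: real assume x: "x \<ge> 1"
      \<comment> \<open>The formal derivative of H(tu)/H(t) in u: the inner factor t cancels in t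
        f(tu)/(tu).\<close>
      define g where "g u = f (t * u) / (u * H t)" for u
      have scale: "set_integrable lborel {1..u} g \<and> H (t * u) / H t = 1 + (LINT v:{1..u}|lborel. g v)"
        if u: "u \<ge> 1" for u
      proof -
        have ind: "(\<lambda>v. indicator {t..t*u} (0 + t * v) *\<^sub>R (f (0 + t * v) / (0 + t * v)))
            = (\<lambda>v. indicator {1..u} v *\<^sub>R (H t / t * g v))"
        proof
          fix v
          have "indicator {t..t*u} (t * v) = (indicator {1..u} v :: real)"
            using Ht by (auto simp: indicator_def)
          then show "indicator {t..t*u} (0 + t * v) *\<^sub>R (f (0 + t * v) / (0 + t * v))
              = indicator {1..u} v *\<^sub>R (H t / t * g v)"
            using Ht by (simp add: g_def)
        qed
        have ratio_nz: "H t / t \<noteq> 0" using Ht by simp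
        have "integrable lborel (\<lambda>s. indicator {t..t*u} s *\<^sub>R (f s / s))"
          using elim(2) u by (simp add: set_integrable_def)
        then have "integrable lborel (\<lambda>v. indicator {t..t*u} (0 + t * v) *\<^sub>R (f (0 + t * v) / (0 + t * v)))"
          using Ht by (subst lborel_integrable_real_affine_iff) auto
        then have "integrable lborel (\<lambda>v. indicator {1..u} v *\<^sub>R (H t / t * g v))" unfolding ind .
        then have int: "set_integrable lborel {1..u} g"
          unfolding set_integrable_def[symmetric] by (simp only: set_integrable_mult_right_iff[OF ratio_nz])
        have "H (t * u) - H t = (LINT s|lborel. indicator {t..t*u} s *\<^sub>R (f s / s))"
          using elim(2) u by (simp add: set_lebesgue_integral_def)
        also have "\<dots> = \<bar>t\<bar> *\<^sub>R (LINT v|lborel. indicator {t..t*u} (0 + t * v) *\<^sub>R (f (0 + t * v) / (0 + t * v)))"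
          using Ht by (intro lborel_integral_real_affine) simp
        also have "\<dots> = H t * (LINT v:{1..u}|lborel. g v)"
          unfolding ind set_lebesgue_integral_def[symmetric] using Ht by simp
        finally have "H (t * u) / H t = 1 + (LINT v:{1..u}|lborel. g v)"
          using Ht by (simp add: field_simps)
        with int show ?thesis by simp
      qed
      have g: "set_integrable lborel {1..x} g" using scale[OF x] by simp
      define G where "G u = (LINT v:{1..u}|lborel. g v)" for u
      have p_eq: "H (t * u) / H t = 1 + G u" if "u \<ge> 1" for u using scale[OF that] by (simp add: G_def)
      define h where "h u = u powr (- a)" for u :: real
      define h' where "h' u = - a * u powr (- a - 1)" for u :: real
      have h: "(h has_real_derivative h' u) (at u within {1..x})" if "u \<in> {1..x}" for u
        unfolding h_def h'_def using that by (auto intro!: derivative_eq_intros)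
      have h'_cont: "continuous_on {1..x} h'" unfolding h'_def by (intro continuous_intros) auto
      have h_cont: "continuous_on {1..x} h" unfolding h_def by (intro continuous_intros) auto
      have G_bound: "\<bar>G u\<bar> \<le> (LINT v:{1..x}|lborel. \<bar>g v\<bar>)" if "u \<in> {1..x}" for u
      proof -
        have int_abs: "set_integrable lborel {1..x} (\<lambda>v. \<bar>g v\<bar>)" using g by (rule set_integrable_abs)
        have "\<bar>G u\<bar> \<le> (LINT v|lborel. \<bar>indicator {1..u} v *\<^sub>R g v\<bar>)"
          unfolding G_def set_lebesgue_integral_def by (rule integral_abs_bound)
        also have "\<dots> \<le> (LINT v|lborel. indicator {1..x} v *\<^sub>R \<bar>g v\<bar>)"
          using int_abs that unfolding set_integrable_def
          by (intro integral_mono_AE' AE_I2) (auto simp: indicator_def)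
        finally show ?thesis by (simp add: set_lebesgue_integral_def)
      qed
      have y_eq: "y t u = h u * (1 + G u)" if "u \<ge> 1" for u
        using p_eq[OF that] by (simp add: y_def h_def)
      have bdd: "bdd_above ((\<lambda>u. \<bar>y t u\<bar>) ` {1..x})"
      proof -
        have "bounded (h ` {1..x})"
          by (intro compact_imp_bounded compact_continuous_image h_cont) simp
        then obtain M where M: "\<And>u. u \<in> {1..x} \<Longrightarrow> \<bar>h u\<bar> \<le> M"
          unfolding bounded_iff real_norm_def by blast
        have "\<bar>y t u\<bar> \<le> M * (1 + (LINT v:{1..x}|lborel. \<bar>g v\<bar>))" if "u \<in> {1..x}" for u
        proof -
          have "\<bar>1 + G u\<bar> \<le> 1 + (LINT v:{1..x}|lborel. \<bar>g v\<bar>)" using G_bound[OF that] by linarith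
          moreover have "0 \<le> M" using M[OF that] by linarith
          ultimately show ?thesis
            using M[OF that] that by (simp add: y_eq abs_mult mult_mono)
        qed
        then show ?thesis by (intro bdd_aboveI2)
      qed
      have hg: "set_integrable lborel {1..x} (\<lambda>v. h v * g v)"
        using h_cont g by (rule set_integrable_continuous_mult)
      have h'_int: "set_integrable lborel {1..x} h'"
        using h'_cont by (rule borel_integrable_atLeastAtMost')
      have G_borel: "set_borel_measurable lborel {1..x} G"
      proof -
        have "(\<lambda>u. indicator {1..x} u *\<^sub>R (H (t * u) / H t - 1)) \<in> borel_measurable lborel" by measurable
        also have "(\<lambda>u. indicator {1..x} u *\<^sub>R (H (t * u) / H t - 1)) = (\<lambda>u. indicator {1..x} u *\<^sub>R G u)"
          by (rule ext) (simp add: p_eq indicator_def)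
        finally show ?thesis by (simp add: set_borel_measurable_def)
      qed
      have h'G: "set_integrable lborel {1..x} (\<lambda>u. h' u * G u)"
      proof (rule set_integrable_bound)
        show "set_integrable lborel {1..x} (\<lambda>u. h' u * (LINT v:{1..x}|lborel. \<bar>g v\<bar>))"
          using h'_int by simp
        have "(\<lambda>u. (indicator {1..x} u *\<^sub>R h' u) * (indicator {1..x} u *\<^sub>R G u)) \<in> borel_measurable lborel"
          by (rule borel_measurable_times[OF borel_measurable_integrable
                [OF h'_int[unfolded set_integrable_def]] G_borel[unfolded set_borel_measurable_def]])
        also have "(\<lambda>u. (indicator {1..x} u *\<^sub>R h' u) * (indicator {1..x} u *\<^sub>R G u))
            = (\<lambda>u. indicator {1..x} u *\<^sub>R (h' u * G u))"
          by (rule ext) (simp add: indicator_def)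
        finally show "set_borel_measurable lborel {1..x} (\<lambda>u. h' u * G u)"
          by (simp add: set_borel_measurable_def)
        show "AE u in lborel. u \<in> {1..x} \<longrightarrow> norm (h' u * G u) \<le> norm (h' u * (LINT v:{1..x}|lborel. \<bar>g v\<bar>))"
        proof (intro AE_I2 impI)
          fix u assume u: "u \<in> {1..x}"
          have "\<bar>h' u\<bar> * \<bar>G u\<bar> \<le> \<bar>h' u\<bar> * \<bar>LINT v:{1..x}|lborel. \<bar>g v\<bar>\<bar>"
            using G_bound[OF u] by (intro mult_left_mono) auto
          then show "norm (h' u * G u) \<le> norm (h' u * (LINT v:{1..x}|lborel. \<bar>g v\<bar>))"
            by (simp add: abs_mult)
        qed
      qed
      \<comment> \<open>The left side is the formal derivative of y = h (1 + G). Because h' = -a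
        h/u, the combination f(tu)/H(tu) - a = e(tu) comes out.\<close>
      have integrand: "h u * g u + h' u + h' u * G u = y t u * e (t * u) / u" if "u \<in> {1..x}" for u
      proof -
        have u: "u > 0" "u \<ge> 1" using that by auto
        have "t \<le> t * u" using u Ht by simp
        then have nz: "H (t * u) \<noteq> 0" using elim(1) by blast
        have h'_u: "h' u = - a * h u / u" using u by (simp add: h'_def h_def powr_diff)
        have "h u * g u + h' u + h' u * G u = h u * g u + h' u * (H (t * u) / H t)"
          using p_eq[OF u(2)] by (simp add: algebra_simps)
        also have "\<dots> = y t u * e (t * u) / u"
          unfolding h'_u g_def y_def e_def h_def[symmetric] using u nz Ht by (simp add: field_simps)
        finally show ?thesis .
      qed
      have all_int: "set_integrable lborel {1..x} (\<lambda>u. h u * g u + h' u + h' u * G u)"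
        using hg h'_int h'G by (intro set_integral_add)
      have int_y: "set_integrable lborel {1..x} (\<lambda>u. y t u * e (t * u) / u)"
        using all_int by (subst set_integrable_cong[OF refl refl integrand[symmetric]])
      have "(LINT u:{1..x}|lborel. y t u * e (t * u) / u) = (LINT u:{1..x}|lborel. h u * g u + h' u + h' u * G u)"
        by (rule set_lebesgue_integral_cong) (use integrand in auto)
      also have "\<dots> = (LINT u:{1..x}|lborel. h u * g u) + (LINT u:{1..x}|lborel. h' u)
          + (LINT u:{1..x}|lborel. h' u * G u)"
        using hg h'_int h'G by (simp add: set_integral_add)
      \<comment> \<open>The subtracted integral of h g cancels the first summand above; with the
        integral of h' there remains h(x) (1 + G(x)) - h(1) = y(x) - 1.\<close>
      also have "(LINT u:{1..x}|lborel. h' u * G u) = h x * G x - (LINT v:{1..x}|lborel. h v * g v)"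
        unfolding G_def by (rule set_integral_primitive_by_parts[OF x g h h'_cont])
      also have "(LINT u:{1..x}|lborel. h' u) = h x - h 1"
        unfolding set_lebesgue_integral_def
        using h by (intro integral_FTC_atLeastAtMost x h'_cont)
          (auto simp: has_real_derivative_iff_has_vector_derivative)
      finally have "y t x = 1 + (LINT u:{1..x}|lborel. y t u * e (t * u) / u)"
        using y_eq[OF x] by (simp add: h_def algebra_simps)
      with int_y bdd show "set_integrable lborel {1..x} (\<lambda>u. y t u * e (t * u) / u) \<and>
        y t x = 1 + (LINT u:{1..x}|lborel. y t u * e (t * u) / u) \<and> bdd_above ((\<lambda>u. \<bar>y t u\<bar>) ` {1..x})"
        by simp
    qed
  qed
  have ind_int: "integrable lborel (\<lambda>u. indicator {1..x::real} u * (C::real))" for x C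
    using borel_integrable_atLeastAtMost'[OF continuous_on_const, of 1 x C] by (simp add: set_integrable_def)
  have estimate: "\<bar>LINT u:{1..x}|lborel. y t u * e (t * u) / u\<bar> \<le> M * \<delta> * K"
    if "t > 0" "x \<in> {1..K}" "\<And>u. u \<in> {1..K} \<Longrightarrow> \<bar>y t u\<bar> \<le> M" "\<And>s. s \<ge> t \<Longrightarrow> \<bar>e s\<bar> \<le> \<delta>"
      "M \<ge> 0" "\<delta> \<ge> 0" for t x M \<delta>
  proof -
    have "\<bar>LINT u:{1..x}|lborel. y t u * e (t * u) / u\<bar>
        \<le> (LINT u|lborel. \<bar>indicator {1..x} u *\<^sub>R (y t u * e (t * u) / u)\<bar>)"
      unfolding set_lebesgue_integral_def by (rule integral_abs_bound)
    also have "\<dots> \<le> (LINT u|lborel. indicator {1..x} u * (M * \<delta>))"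
    proof (intro integral_mono_AE' AE_I2)
      fix u :: real
      show "\<bar>indicator {1..x} u *\<^sub>R (y t u * e (t * u) / u)\<bar> \<le> indicator {1..x} u * (M * \<delta>)"
      proof (cases "u \<in> {1..x}")
        case True
        then have u: "u \<ge> 1" "u \<in> {1..K}" using that(2) by auto
        have "t \<le> t * u" using u that(1) by simp
        then have "\<bar>y t u\<bar> * \<bar>e (t * u)\<bar> / u \<le> M * \<delta> / 1"
          using u that by (intro frac_le mult_mono) auto
        then show ?thesis using True u by (simp add: abs_mult)
      qed simp
    qed (use that ind_int in simp_all)
    also have "\<dots> = (x - 1) * (M * \<delta>)" using that(2) by simp
    also have "\<dots> \<le> K * (M * \<delta>)" using that by (intro mult_right_mono) auto
    finally show ?thesis by (simp add: mult_ac)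
  qed
  have e_small: "\<forall>\<^sub>F t in at_top. \<forall>s\<ge>t. \<bar>e s\<bar> \<le> \<delta>" if "\<delta> > 0" for \<delta>
  proof -
    have "\<forall>\<^sub>F t in at_top. \<bar>e t\<bar> \<le> \<delta>"
      using tendstoD[OF e_null that] by eventually_elim simp
    then show ?thesis by (rule eventually_all_ge_at_top)
  qed
  have y_bound: "\<forall>\<^sub>F t in at_top. \<forall>u\<in>{1..K}. \<bar>y t u\<bar> \<le> 2"
  proof -
    \<comment> \<open>With |e| \<le> 1/(2K) the integral term is at most S/2, where S is the
      supremum of |y| on [1, K], finite by the last component of \<open>volterra\<close>. Hence S
      \<le> 1 + S/2, that is S \<le> 2.\<close>
    have "1 / (2 * K) > 0" using K by simp
    from volterra e_small[OF this] eventually_gt_at_top[of 0] show ?thesis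
    proof eventually_elim
      case (elim t)
      define S where "S = (SUP u\<in>{1..K}. \<bar>y t u\<bar>)"
      have bdd: "bdd_above ((\<lambda>u. \<bar>y t u\<bar>) ` {1..K})" using elim(1)[rule_format, OF K] by (elim conjE)
      have S: "\<bar>y t u\<bar> \<le> S" if "u \<in> {1..K}" for u
        unfolding S_def using that bdd by (rule cSUP_upper)
      have S0: "S \<ge> 0" using S[of 1] K by auto
      have "S \<le> 1 + S / 2"
        unfolding S_def
      proof (rule cSUP_least)
        fix x assume x: "x \<in> {1..K}"
        have "\<bar>LINT u:{1..x}|lborel. y t u * e (t * u) / u\<bar> \<le> S * (1 / (2 * K)) * K"
          using elim K S S0 by (intro estimate x) auto
        moreover have "y t x = 1 + (LINT u:{1..x}|lborel. y t u * e (t * u) / u)" using elim x by auto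
        ultimately show "\<bar>y t x\<bar> \<le> 1 + (SUP u\<in>{1..K}. \<bar>y t u\<bar>) / 2"
          using K unfolding S_def[symmetric] by simp
      qed (use K in auto)
      then show ?case using S by fastforce
    qed
  qed
  have y_lim: "((\<lambda>t. y t u) \<longlongrightarrow> 1) at_top" if u: "u \<in> {1..K}" for u
  proof (rule tendstoI)
    fix \<epsilon> :: real assume \<epsilon>: "\<epsilon> > 0"
    \<comment> \<open>Together with |y| \<le> 2, the bound |e| \<le> \<epsilon>/(4K) leaves an error
      of at most \<epsilon>/2.\<close>
    then have "\<epsilon> / (4 * K) > 0" using K by simp
    from volterra y_bound e_small[OF this] eventually_gt_at_top[of 0]
    show "\<forall>\<^sub>F t in at_top. dist (y t u) 1 < \<epsilon>"
    proof eventually_elim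
      case (elim t)
      have "\<bar>LINT v:{1..u}|lborel. y t v * e (t * v) / v\<bar> \<le> 2 * (\<epsilon> / (4 * K)) * K"
        using elim K \<epsilon> by (intro estimate u) auto
      also have "\<dots> < \<epsilon>" using K \<epsilon> by simp
      finally show ?case using elim u by (simp add: dist_real_def)
    qed
  qed
  obtain CA TA where CA: "CA > 0" "\<And>t x. t \<ge> TA \<Longrightarrow> x \<in> {1..K} \<Longrightarrow> \<bar>A (t * x) / A t\<bar> \<le> CA"
    using A_locally_bounded[OF K] by metis
  have e_A: "\<forall>\<^sub>F t in at_top. \<forall>s\<ge>t. \<bar>e s / A s\<bar> \<le> \<bar>c\<bar> + 1"
  proof -
    have "\<forall>\<^sub>F t in at_top. dist (e t / A t) c < 1"
      using lim unfolding e_def by (rule tendstoD) simp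
    then have "\<forall>\<^sub>F t in at_top. \<bar>e t / A t\<bar> \<le> \<bar>c\<bar> + 1"
    proof eventually_elim
      case (elim t)
      then show ?case using abs_triangle_ineq2[of "e t / A t" c] by (simp only: dist_real_def)
    qed
    then show ?thesis by (rule eventually_all_ge_at_top)
  qed
  \<comment> \<open>The Volterra integrand divided by \<open>A t\<close>, factored so that the
    pieces have limits of their own: 1 for y, c for e/A at tu, and u^\<rho> for the ratio of
    \<open>A\<close>.\<close>
  define s where "s t u = indicator {1..K} u * (y t u * (e (t * u) / A (t * u)) * (A (t * u) / A t) / u)" for t u
  have s_lim: "((\<lambda>t. LINT u|lborel. s t u) \<longlongrightarrow> (LINT u|lborel. indicator {1..K} u * (1 * c * u powr \<rho> / u))) at_top"
  proof (rule integral_dominated_convergence_at_top)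
    show "integrable lborel (\<lambda>u. indicator {1..K} u * (2 * (\<bar>c\<bar> + 1) * CA))" by (rule ind_int)
    show "AE u in lborel. ((\<lambda>t. s t u) \<longlongrightarrow> indicator {1..K} u * (1 * c * u powr \<rho> / u)) at_top"
    proof (intro AE_I2)
      fix u :: real
      show "((\<lambda>t. s t u) \<longlongrightarrow> indicator {1..K} u * (1 * c * u powr \<rho> / u)) at_top"
      proof (cases "u \<in> {1..K}")
        case True
        then have u: "u > 0" by auto
        have "((\<lambda>t. e (t * u) / A (t * u)) \<longlongrightarrow> c) at_top"
          using filterlim_compose[OF lim filterlim_mult_const_at_top[OF u]] by (simp add: e_def)
        then show ?thesis unfolding s_def
          using u True by (intro tendsto_intros y_lim A_ratio) auto
      qed (simp add: s_def)
    qed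
    show "\<forall>\<^sub>F t in at_top. AE u in lborel. norm (s t u) \<le> indicator {1..K} u * (2 * (\<bar>c\<bar> + 1) * CA)"
      using y_bound e_A eventually_ge_at_top[of TA] eventually_gt_at_top[of 0]
    proof eventually_elim
      case (elim t)
      show ?case
      proof (intro AE_I2)
        fix u :: real
        show "norm (s t u) \<le> indicator {1..K} u * (2 * (\<bar>c\<bar> + 1) * CA)"
        proof (cases "u \<in> {1..K}")
          case True
          then have u: "u \<ge> 1" by auto
          have "t \<le> t * u" using u elim by simp
          then have "\<bar>y t u\<bar> * \<bar>e (t * u) / A (t * u)\<bar> * \<bar>A (t * u) / A t\<bar> / u \<le> 2 * (\<bar>c\<bar> + 1) * CA / 1"
            using u True elim CA by (intro frac_le mult_mono mult_nonneg_nonneg) auto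
          moreover have "0 \<le> (2 * \<bar>c\<bar> + 2) * CA" using CA(1) by simp
          ultimately show ?thesis using True u by (simp add: s_def abs_mult split: if_splits)
        qed (simp add: s_def)
      qed
    qed
  qed (unfold s_def, measurable)
  have "(LINT u|lborel. indicator {1..K} u *\<^sub>R (u powr \<rho> / u)) = power_kernel \<rho> K - power_kernel \<rho> 1"
  proof (rule integral_FTC_atLeastAtMost[OF K])
    show "continuous_on {1..K} (\<lambda>u. u powr \<rho> / u)" by (intro continuous_intros) auto
    fix u :: real assume "1 \<le> u" "u \<le> K"
    then have "(power_kernel \<rho> has_real_derivative u powr \<rho> / u) (at u within {1..K})"
      using has_field_derivative_at_within[OF power_kernel_has_derivative[of u \<rho>]] by (simp add: powr_diff)
    then show "(power_kernel \<rho> has_vector_derivative u powr \<rho> / u) (at u within {1..K})"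
      by (simp only: has_real_derivative_iff_has_vector_derivative)
  qed
  then have ker: "(LINT u|lborel. indicator {1..K} u * (u powr \<rho> / u)) = power_kernel \<rho> K"
    by (simp add: power_kernel_def)
  have "(LINT u|lborel. indicator {1..K} u * (1 * c * u powr \<rho> / u))
      = (LINT u|lborel. c * (indicator {1..K} u * (u powr \<rho> / u)))"
    by (rule Bochner_Integration.integral_cong) auto
  also have "\<dots> = c * power_kernel \<rho> K" unfolding ker[symmetric] by (rule integral_mult_right_zero)
  finally have "((\<lambda>t. K powr a * (LINT u|lborel. s t u)) \<longlongrightarrow> K powr a * (c * power_kernel \<rho> K)) at_top"
    using s_lim by (intro tendsto_intros) simp
  then have "((\<lambda>t. K powr a * (LINT u|lborel. s t u)) \<longlongrightarrow> c * (K powr a * power_kernel \<rho> K)) at_top"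
    by (simp add: mult_ac)
  then show ?thesis
  proof (rule Lim_transform_eventually)
    show "\<forall>\<^sub>F t in at_top. K powr a * (LINT u|lborel. s t u) = (H (t * K) / H t - K powr a) / A t"
      using volterra nz_ge eventually_gt_at_top[of 0]
    proof eventually_elim
      case (elim t)
      have "(LINT u:{1..K}|lborel. y t u * e (t * u) / u) = (LINT u|lborel. A t * s t u)"
        unfolding set_lebesgue_integral_def
      proof (rule Bochner_Integration.integral_cong[OF refl])
        fix u :: real
        show "indicator {1..K} u *\<^sub>R (y t u * e (t * u) / u) = A t * s t u"
        proof (cases "u \<in> {1..K}")
          case True
          then have "t \<le> t * u" using elim by simp
          then have "A (t * u) \<noteq> 0" "A t \<noteq> 0" using elim by auto
          then show ?thesis using True by (simp add: s_def)
        qed (simp add: s_def)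
      qed
      then have "y t K = 1 + A t * (LINT u|lborel. s t u)" using elim K by simp
      moreover have "H (t * K) / H t = K powr a * y t K"
        using K by (simp add: y_def powr_minus)
      moreover have "A t \<noteq> 0" using elim by auto
      ultimately show ?case by (simp add: algebra_simps)
    qed
  qed
qed

end

section \<open>Splitting, positivity and convergence of integrals\<close>

lemma set_integral_adjacent:
  fixes g :: "real \<Rightarrow> real"
  assumes "set_integrable lborel S g" "set_integrable lborel S' g" "S \<inter> S' \<subseteq> {b}"
    "S \<in> sets lborel" "S' \<in> sets lborel"
  shows "(LINT s:S \<union> S'|lborel. g s) = (LINT s:S|lborel. g s) + (LINT s:S'|lborel. g s)"
proof (rule set_integral_Un_AE)
  show "AE s in lborel. \<not> (s \<in> S \<and> s \<in> S')"
    using AE_lborel_singleton[of b] by eventually_elim (use assms(3) in auto)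
qed (use assms in auto)

lemma set_integral_pos:
  fixes g :: "real \<Rightarrow> real"
  assumes "set_integrable lborel S g" "\<And>s. s \<in> S \<Longrightarrow> g s > 0" "S \<in> sets lborel" "{b..c} \<subseteq> S" "b < c"
  shows "(LINT s:S|lborel. g s) > 0"
proof -
  have nonneg: "(LINT s:S|lborel. g s) \<ge> 0"
    unfolding set_lebesgue_integral_def
    by (intro integral_nonneg_AE AE_I2) (auto simp: indicator_def less_imp_le assms(2))
  have "(LINT s:S|lborel. g s) \<noteq> 0"
  proof
    assume 0: "(LINT s:S|lborel. g s) = 0"
    have "S \<in> null_sets lborel"
    proof (rule null_if_pos_func_has_zero_int)
      show "integrable lborel (\<lambda>s. indicator S s *\<^sub>R g s)"
        using assms(1) by (simp only: set_integrable_def)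
      show "AE s\<in>S in lborel. 0 < indicator S s *\<^sub>R g s"
        using assms(2) by (intro AE_I2) simp
      have "(\<lambda>s. indicator S s *\<^sub>R (indicator S s *\<^sub>R g s)) = (\<lambda>s. indicator S s *\<^sub>R g s)"
        by (auto simp: indicator_def)
      then show "(LINT s:S|lborel. indicator S s *\<^sub>R g s) = 0"
        using 0 by (simp only: set_lebesgue_integral_def)
    qed (rule assms(3))
    then have "{b..c} \<in> null_sets lborel"
      by (rule null_sets_subset) (use assms(4) in simp_all)
    then have "emeasure lborel {b..c} = 0" by (rule null_setsD1)
    then show False using \<open>b < c\<close> by (simp add: emeasure_lborel_Icc)
  qed
  with nonneg show ?thesis by simp
qed

text \<open>Over [y, 2y] the integral is at most C f(y) by the local bound, and f(2y) \<le> q f(y)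
  with q < 1 because a < 0, so the dyadic blocks are dominated by a geometric series. Positivity
  turns bounded partial integrals into integrability.\<close>

lemma regular_variation_integrable_at_top:
  fixes f :: "real \<Rightarrow> real"
  assumes f_borel [measurable]: "f \<in> borel_measurable borel"
    and f_pos: "\<forall>\<^sub>F t in at_top. f t > 0"
    and lim: "\<And>x. x \<ge> 1 \<Longrightarrow> ((\<lambda>t. f (t * x) / f t) \<longlongrightarrow> x powr a) at_top"
    and a: "a < 0"
  shows "\<forall>\<^sub>F T in at_top. set_integrable lborel {T..} (\<lambda>s. f s / s)"
proof -
  have f_nz: "\<forall>\<^sub>F t in at_top. f t \<noteq> 0" using f_pos by eventually_elim simp
  obtain C T1 where C: "C > 0" "\<And>t x. t \<ge> T1 \<Longrightarrow> x \<in> {1..2} \<Longrightarrow> \<bar>f (t * x) / f t\<bar> \<le> C"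
    using regular_variation_locally_bounded[OF f_borel f_nz lim one_le_numeral] by metis
  have "2 powr a < (1::real)" using powr_less_mono[of a 0 2] a by simp
  then obtain q where q: "2 powr a < q" "q < 1" using dense by blast
  have "\<forall>\<^sub>F t in at_top. f (t * 2) / f t < q"
    using lim[of 2] q by (intro order_tendstoD(2)[of _ "2 powr a"]) auto
  with f_pos obtain T2 where T2: "\<And>t. t \<ge> T2 \<Longrightarrow> f t > 0 \<and> f (t * 2) / f t < q"
    unfolding eventually_at_top_linorder by (metis le_max_iff_disj linorder_le_cases order_trans)
  show ?thesis
    using eventually_ge_at_top[of "max (max T1 T2) 1"]
  proof eventually_elim
    case (elim T)
    have dyadic: "set_integrable lborel {y..2*y} (\<lambda>s. f s / s) \<and> (LINT s:{y..2*y}|lborel. f s / s) \<le> C * f y"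
      if y: "y \<ge> T" for y
    proof -
      have y0: "y > 0" "f y > 0" using y elim T2[of y] by auto
      have bound: "0 \<le> f s / s \<and> f s / s \<le> C * f y / y" if s: "s \<in> {y..2*y}" for s
      proof -
        have fs: "f s > 0" "s > 0" using T2[of s] s y elim by auto
        have "s / y \<in> {1..2}" using s y0 by (auto simp: field_simps)
        then have "f s \<le> C * f y"
          using C(2)[of y "s / y"] y elim y0 fs by (simp add: pos_divide_le_eq)
        then have "f s / s \<le> C * f y / y"
          using s y0 fs by (intro frac_le) auto
        then show ?thesis using fs by simp
      qed
      have const: "set_integrable lborel {y..2*y} (\<lambda>s. C * f y / y)"
        by (intro borel_integrable_atLeastAtMost' continuous_intros)
      have int: "set_integrable lborel {y..2*y} (\<lambda>s. f s / s)"
      proof (rule set_integrable_bound[OF const])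
        show "set_borel_measurable lborel {y..2*y} (\<lambda>s. f s / s)"
          unfolding set_borel_measurable_def by measurable
        show "AE s in lborel. s \<in> {y..2*y} \<longrightarrow> norm (f s / s) \<le> norm (C * f y / y)"
        proof (intro AE_I2 impI)
          fix s assume "s \<in> {y..2*y}"
          from bound[OF this] show "norm (f s / s) \<le> norm (C * f y / y)"
            unfolding real_norm_def by linarith
        qed
      qed
      have "(LINT s:{y..2*y}|lborel. f s / s) \<le> (LINT s:{y..2*y}|lborel. C * f y / y)"
        using int const by (rule set_integral_mono) (use bound in blast)
      also have "\<dots> = C * f y"
        using y0 by (simp add: set_lebesgue_integral_def)
      finally show ?thesis using int by simp
    qed
    define I where "I i = (LINT s:{T..2^i * T}|lborel. f s / s)" for i
    \<comment> \<open>\<open>E i\<close> is the sum of the series C f(2^i T) (1 + q + q^2 + ...), a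
      bound for what lies beyond 2^i T. Hence \<open>I i + E i\<close> does not increase with i, and
      \<open>E 0\<close> bounds every \<open>I i\<close>.\<close>
    define E where "E i = C * f (2^i * T) / (1 - q)" for i
    have T_le: "T \<le> 2^i * T" for i
      using elim mult_right_mono[of 1 "2^i" T] by simp
    have step: "set_integrable lborel {T..2^i * T} (\<lambda>s. f s / s) \<and> I i + E i \<le> E 0" for i
    proof (induction i)
      case 0
      have "set_integrable lborel {T..2*T} (\<lambda>s. f s / s)" using dyadic[of T] by simp
      then have "set_integrable lborel {T..T} (\<lambda>s. f s / s)"
        by (rule set_integrable_subset) (use elim in simp_all)
      moreover have "(LINT s:{T}|lborel. f s / s) = 0"
        by (subst set_integral_at_point) (use calculation in simp_all)
      ultimately show ?case by (simp add: I_def)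
    next
      case (Suc i)
      define y where "y = 2^i * T"
      have y: "y \<ge> T" using T_le by (simp add: y_def)
      have fy: "f y > 0" using T2[of y] y elim by auto
      have "{T..2^Suc i * T} = {T..2*y}" by (simp add: y_def mult.assoc)
      also have "{T..2*y} = {T..y} \<union> {y..2*y}" using y elim by auto
      finally have Un: "{T..2^Suc i * T} = {T..y} \<union> {y..2*y}" .
      have ih: "set_integrable lborel {T..y} (\<lambda>s. f s / s)" "I i + E i \<le> E 0"
        using Suc by (auto simp: y_def)
      have int: "set_integrable lborel {T..2^Suc i * T} (\<lambda>s. f s / s)"
        unfolding Un using ih dyadic[OF y] by (intro set_integrable_Un) auto
      have "I (Suc i) = I i + (LINT s:{y..2*y}|lborel. f s / s)"
        unfolding I_def Un y_def[symmetric]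
        using ih dyadic[OF y] by (intro set_integral_adjacent[of _ _ _ y]) auto
      also have "\<dots> \<le> I i + C * f y" using dyadic[OF y] by simp
      finally have I: "I (Suc i) \<le> I i + C * f y" .
      have "f (2 * y) \<le> q * f y"
        using T2[of y] y elim fy by (auto simp: pos_divide_less_eq mult.commute)
      then have "C * f (2 * y) / (1 - q) \<le> C * (q * f y) / (1 - q)"
        using C(1) q by (intro divide_right_mono mult_left_mono) auto
      then have "E (Suc i) \<le> C * (q * f y) / (1 - q)"
        by (simp add: E_def y_def mult.assoc)
      also have "\<dots> = E i - C * f y"
      proof -
        have "E i = C * f y / (1 - q)" by (simp add: E_def y_def)
        then show ?thesis using q by (simp add: field_simps)
      qed
      finally show ?case using I ih int by simp
    qed
    have E_nonneg: "E i \<ge> 0" for i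
    proof -
      have "f (2^i * T) > 0" using T2[of "2^i * T"] T_le[of i] elim by auto
      then show ?thesis using C(1) q by (simp add: E_def)
    qed
    have pos: "0 \<le> f s / s" if "s \<ge> T" for s
    proof -
      have "f s > 0" "s > 0" using T2[of s] that elim by auto
      then show ?thesis by simp
    qed
    have sets_mono: "{T..2^i * T} \<subseteq> {T..2^j * T}" if "i \<le> j" for i j :: nat
    proof -
      have "2^i * T \<le> 2^j * T" using that elim by (intro mult_right_mono power_increasing) auto
      then show ?thesis by auto
    qed
    have "incseq I"
    proof (rule incseq_SucI)
      fix i
      show "I i \<le> I (Suc i)"
        unfolding I_def set_lebesgue_integral_def
      proof (rule integral_mono_AE)
        show "AE s in lborel. indicator {T..2^i * T} s *\<^sub>R (f s / s) \<le> indicator {T..2^Suc i * T} s *\<^sub>R (f s / s)"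
        proof (intro AE_I2)
          fix s
          show "indicator {T..2^i * T} s *\<^sub>R (f s / s) \<le> indicator {T..2^Suc i * T} s *\<^sub>R (f s / s)"
            using sets_mono[of i "Suc i"] pos[of s] by (auto simp: indicator_def)
        qed
      qed (use step[of i] step[of "Suc i"] in \<open>simp_all add: set_integrable_def\<close>)
    qed
    moreover have "I i \<le> E 0" for i using step[of i] E_nonneg[of i] by simp
    ultimately obtain l where l: "I \<longlonglongrightarrow> l" by (metis incseq_convergent)
    have "set_integrable lborel (\<Union>i. {T..2^i * T}) (\<lambda>s. f s / s)"
    proof (rule pos_integrable_to_top)
      show "mono (\<lambda>i. {T..2^i * T})" by (intro monoI sets_mono)
      show "(\<lambda>i. LINT s:{T..2^i * T}|lborel. f s / s) \<longlonglongrightarrow> l" using l unfolding I_def .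
      show "set_integrable lborel {T..2^i * T} (\<lambda>s. f s / s)" for i using step[of i] by (rule conjunct1)
      show "0 \<le> f s / s" if "s \<in> {T..2^i * T}" for s i using that by (intro pos) simp
    qed simp
    also have "(\<Union>i. {T..2^i * T}) = {T..}"
    proof -
      have "\<exists>i. s \<le> 2^i * T" for s
      proof -
        obtain i where "s / T < 2^i" using real_arch_pow[of 2 "s / T"] by auto
        then show ?thesis using elim by (intro exI[of _ i]) (simp add: pos_divide_less_eq)
      qed
      then show ?thesis by auto
    qed
    finally show ?case .
  qed
qed

section \<open>The return from the primitive to the integrand\<close>

context null_RV
begin

text \<open>Since f = H (a + e), the ratio of \<open>f\<close> is r R, where r is the ratio of
  \<open>H\<close> and R = (a + e(tx))/(a + e(t)). Divided by A(t), r - x^a and R - 1 tend to c x^a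
  k(x) and c (x^\<rho> - 1)/a = c \<rho> k(x)/a. The total x^a k(x) c (1 + \<rho>/a) is the wanted
  limit for c = a/(a+\<rho>).\<close>

lemma karamata_converse:
  fixes f H :: "real \<Rightarrow> real"
  assumes borel: "f \<in> borel_measurable borel" "H \<in> borel_measurable borel"
    and H_nz: "\<forall>\<^sub>F t in at_top. H t \<noteq> 0"
    and H: "\<forall>\<^sub>F t in at_top. \<forall>x\<ge>1. set_integrable lborel {t..t*x} (\<lambda>s. f s / s) \<and>
        H (t * x) - H t = (LINT s:{t..t*x}|lborel. f s / s)"
    and lim: "((\<lambda>t. (f t / H t - a) / A t) \<longlongrightarrow> a / (a + \<rho>)) at_top"
    and a: "a \<noteq> 0" "a + \<rho> \<noteq> 0"
    and x: "x > 0"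
  shows "((\<lambda>t. (H (t * x) / H t - x powr a) / A t) \<longlongrightarrow> a / (a + \<rho>) * (x powr a * power_kernel \<rho> x)) at_top" (is ?H)
    and "((\<lambda>t. (f (t * x) / f t - x powr a) / A t) \<longlongrightarrow> x powr a * power_kernel \<rho> x) at_top" (is ?f)
proof -
  define c where "c = a / (a + \<rho>)"
  show H_lim: ?H
    by (rule second_order_extend[OF H_nz karamata_converse_ge1[OF borel H_nz H lim] x])
  define r where "r t = H (t * x) / H t" for t
  define e where "e t = f t / H t - a" for t
  have e_null: "(e \<longlongrightarrow> 0) at_top"
    using ratio_of_second_order[OF lim] unfolding e_def by (intro LIM_zero)
  have e_lim: "((\<lambda>t. e t / A t) \<longlongrightarrow> c) at_top" using lim by (simp add: e_def c_def)
  have tx: "filterlim (\<lambda>t. t * x) at_top at_top" using x by (rule filterlim_mult_const_at_top)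
  have r_lim: "((\<lambda>t. (r t - x powr a) / A t) \<longlongrightarrow> c * (x powr a * power_kernel \<rho> x)) at_top"
    using H_lim by (simp add: r_def c_def)
  \<comment> \<open>The expansion r R - x^a = (r - x^a) R + x^a (R - 1), divided by
    \<open>A t\<close>; the difference e(tx) - e(t) is expressed through e/A at both points.\<close>
  have "((\<lambda>t. (r t - x powr a) / A t * ((a + e (t * x)) / (a + e t))
        + x powr a * ((e (t * x) / A (t * x) * (A (t * x) / A t) - e t / A t) / (a + e t)))
      \<longlongrightarrow> c * (x powr a * power_kernel \<rho> x) * ((a + 0) / (a + 0))
        + x powr a * ((c * x powr \<rho> - c) / (a + 0))) at_top"
    using a by (intro tendsto_intros r_lim e_null e_lim A_ratio x
        filterlim_compose[OF e_null tx] filterlim_compose[OF e_lim tx]) auto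
  also have "c * (x powr a * power_kernel \<rho> x) * ((a + 0) / (a + 0))
        + x powr a * ((c * x powr \<rho> - c) / (a + 0)) = x powr a * power_kernel \<rho> x"
  proof -
    have k: "x powr \<rho> - 1 = \<rho> * power_kernel \<rho> x"
      using x by (simp add: power_kernel_def)
    have "(c * x powr \<rho> - c) / (a + 0) = c * (x powr \<rho> - 1) / a" by (simp add: algebra_simps)
    also have "\<dots> = c * \<rho> * power_kernel \<rho> x / a" unfolding k by simp
    finally have "c * (x powr a * power_kernel \<rho> x) * ((a + 0) / (a + 0))
        + x powr a * ((c * x powr \<rho> - c) / (a + 0)) = x powr a * power_kernel \<rho> x * (c * (1 + \<rho> / a))"
      using a by (simp add: algebra_simps)
    also have "c * (1 + \<rho> / a) = 1"
    proof -
      have "1 + \<rho> / a = (a + \<rho>) / a" using a by (simp add: add_divide_distrib)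
      then show ?thesis using a by (simp add: c_def)
    qed
    finally show ?thesis by simp
  qed
  finally show ?f
  proof (rule Lim_transform_eventually)
    have "\<forall>\<^sub>F t in at_top. a + e t \<noteq> 0"
      by (rule tendsto_imp_eventually_ne[OF tendsto_add[OF tendsto_const e_null]]) (use a in simp)
    then show "\<forall>\<^sub>F t in at_top. (r t - x powr a) / A t * ((a + e (t * x)) / (a + e t))
        + x powr a * ((e (t * x) / A (t * x) * (A (t * x) / A t) - e t / A t) / (a + e t))
        = (f (t * x) / f t - x powr a) / A t"
      using H_nz A_nonzero filterlim_iff[THEN iffD1, OF tx, rule_format, OF H_nz]
        filterlim_iff[THEN iffD1, OF tx, rule_format, OF A_nonzero]
    proof eventually_elim
      case (elim t)
      have f_eq: "f s = H s * (a + e s)" if "H s \<noteq> 0" for s using that by (simp add: e_def)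
      define R where "R = (a + e (t * x)) / (a + e t)"
      have 1: "f (t * x) / f t = r t * R" unfolding R_def
        using elim by (simp add: f_eq r_def)
      have 2: "e (t * x) / A (t * x) * (A (t * x) / A t) - e t / A t = (e (t * x) - e t) / A t"
        using elim by (simp add: diff_divide_distrib)
      have 3: "(e (t * x) - e t) / A t / (a + e t) = (R - 1) / A t"
        using elim unfolding R_def by (simp add: field_simps)
      show ?case unfolding 1 2 3 R_def[symmetric]
        by (simp add: diff_divide_distrib right_diff_distrib left_diff_distrib)
    qed
  qed
qed

end

section \<open>From functions on the positive half-line to total Borel functions\<close>

text \<open>Extension by zero turns measurability on the subspace into Borel measurability on the
  line, and limits at infinity do not see it.\<close>

definition restrict_pos :: "(real \<Rightarrow> real) \<Rightarrow> real \<Rightarrow> real" where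
  "restrict_pos F x = (if x > 0 then F x else 0)"

lemma measurable_pos_iff: "measurable_pos F \<longleftrightarrow> restrict_pos F \<in> borel_measurable borel"
proof -
  have "(\<lambda>x. indicator {0<..} x *\<^sub>R F x) = restrict_pos F"
    by (auto simp: restrict_pos_def indicator_def)
  then show ?thesis
    unfolding measurable_pos_def by (subst borel_measurable_restrict_space_iff) auto
qed

lemma borel_imp_measurable_pos:
  assumes [measurable]: "F \<in> borel_measurable borel"
  shows "measurable_pos F"
  unfolding measurable_pos_iff restrict_pos_def by measurable

lemma atLeast_split: "(b::real) \<le> c \<Longrightarrow> {b..} = {b..c} \<union> {c..}"
  by auto

lemma eventually_restrict_pos: "\<forall>\<^sub>F t in at_top. restrict_pos F t = F t"
  using eventually_gt_at_top[of 0] by eventually_elim (simp add: restrict_pos_def)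

locale karamata_data =
  fixes F A :: "real \<Rightarrow> real" and \<rho> :: real
  assumes F_measurable: "measurable_pos F"
    and F_pos: "\<forall>x>0. F x > 0"
    and F_bounded: "locally_bounded_pos F"
    and \<rho>_le_0: "\<rho> \<le> 0"
    and A_RV_null: "A \<in> RV_null \<rho>"
begin

lemma A_sign: "constant_sign_at_top A"
  using A_RV_null by (auto simp: RV_null_def RV_def)

end

sublocale karamata_data \<subseteq> null_RV "restrict_pos A" \<rho>
proof
  show "restrict_pos A \<in> borel_measurable borel"
    using A_RV_null by (auto simp: RV_null_def RV_def measurable_pos_iff)
  have "\<forall>\<^sub>F t in at_top. A t \<noteq> 0"
    using A_sign unfolding constant_sign_at_top_def by (auto elim: eventually_mono)
  then show "\<forall>\<^sub>F t in at_top. restrict_pos A t \<noteq> 0"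
    using eventually_restrict_pos[of A] by eventually_elim simp
  have "(A \<longlongrightarrow> 0) at_top" using A_RV_null by (simp add: RV_null_def)
  then show "(restrict_pos A \<longlongrightarrow> 0) at_top"
    using eventually_restrict_pos[of A] by (simp add: tendsto_cong)
  show "((\<lambda>t. restrict_pos A (t * x) / restrict_pos A t) \<longlongrightarrow> x powr \<rho>) at_top" if x: "x > 0" for x
  proof (rule Lim_transform_eventually)
    show "((\<lambda>t. A (t * x) / A t) \<longlongrightarrow> x powr \<rho>) at_top"
      using A_RV_null x by (auto simp: RV_null_def RV_def)
    show "\<forall>\<^sub>F t in at_top. A (t * x) / A t = restrict_pos A (t * x) / restrict_pos A t"
      using eventually_gt_at_top[of 0] by eventually_elim (use x in \<open>simp add: restrict_pos_def\<close>)
  qed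
qed

context karamata_data
begin

text \<open>The constant moves from the limit into the auxiliary function, and c > 0 preserves the
  sign of \<open>A\<close> near infinity. First-order regular variation comes from the second-order
  limit.\<close>

lemma RV2_scaledI:
  assumes meas: "measurable_pos H" and pos: "\<forall>\<^sub>F t in at_top. H t > 0" and c: "c > 0"
    and lim: "\<And>x. x > 0 \<Longrightarrow> ((\<lambda>t. (H (t * x) / H t - x powr a) / restrict_pos A t)
        \<longlongrightarrow> c * (x powr a * power_kernel \<rho> x)) at_top"
  shows "H \<in> RV2 a \<rho> (\<lambda>t. c * A t)"
  unfolding RV2_def RV_def mem_Collect_eq
proof (intro conjI allI impI)
  show "constant_sign_at_top H" using pos by (simp add: constant_sign_at_top_def)
  show "constant_sign_at_top (\<lambda>t. c * A t)"
    using A_sign c by (simp add: constant_sign_at_top_def zero_less_mult_iff mult_less_0_iff)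
  fix x :: real assume x: "x > 0"
  show "((\<lambda>t. H (t * x) / H t) \<longlongrightarrow> x powr a) at_top"
    by (rule ratio_of_second_order[OF lim[OF x]])
  have "((\<lambda>t. (H (t * x) / H t - x powr a) / restrict_pos A t / c)
      \<longlongrightarrow> c * (x powr a * power_kernel \<rho> x) / c) at_top"
    using c by (intro tendsto_intros lim x) simp
  also have "c * (x powr a * power_kernel \<rho> x) / c = x powr a * (LBINT u=1..x. u powr (\<rho> - 1))"
    using c x by (simp add: interval_integral_powr_eq_power_kernel)
  finally show "((\<lambda>t. (H (t * x) / H t - x powr a) / (c * A t))
      \<longlongrightarrow> x powr a * (LBINT u=1..x. u powr (\<rho> - 1))) at_top"
  proof (rule Lim_transform_eventually)
    show "\<forall>\<^sub>F t in at_top. (H (t * x) / H t - x powr a) / restrict_pos A t / c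
        = (H (t * x) / H t - x powr a) / (c * A t)"
      using eventually_restrict_pos[of A] by eventually_elim (simp add: mult.commute)
  qed
qed (rule meas)

definition weighted :: "real \<Rightarrow> real \<Rightarrow> real" where
  "weighted \<theta> t = t powr \<theta> * restrict_pos F t"

lemma weighted_borel [measurable]: "weighted \<theta> \<in> borel_measurable borel"
  using F_measurable unfolding weighted_def measurable_pos_iff by measurable

lemma weighted_pos: "t > 0 \<Longrightarrow> weighted \<theta> t > 0"
  using F_pos by (simp add: weighted_def restrict_pos_def)

lemma weighted_nonneg: "weighted \<theta> t \<ge> 0"
  using F_pos by (simp add: weighted_def restrict_pos_def less_imp_le)

lemma weighted_div: "s \<ge> 0 \<Longrightarrow> weighted \<theta> s / s = s powr (\<theta> - 1) * F s"
  by (cases "s = 0") (auto simp: weighted_def restrict_pos_def powr_diff)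

lemma eventually_weighted_pos: "\<forall>\<^sub>F t in at_top. weighted \<theta> t > 0"
  using eventually_gt_at_top[of 0] by eventually_elim (rule weighted_pos)

text \<open>Multiplying a function by t^\<theta> multiplies its ratios by x^\<theta>; this shifts
  the first-order index and leaves \<rho> and \<open>A\<close> unchanged.\<close>

lemma RV2_iff_weighted:
  "F \<in> RV2 \<alpha> \<rho> A \<longleftrightarrow> (\<forall>x>0. ((\<lambda>t. (weighted \<theta> (t * x) / weighted \<theta> t - x powr (\<alpha> + \<theta>)) / restrict_pos A t)
      \<longlongrightarrow> x powr (\<alpha> + \<theta>) * power_kernel \<rho> x) at_top)" (is "_ \<longleftrightarrow> ?R")
proof
  have ratio: "\<forall>\<^sub>F t in at_top. weighted \<theta> (t * x) / weighted \<theta> t = x powr \<theta> * (F (t * x) / F t)"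
    if "x > 0" for x
    using eventually_gt_at_top[of 0]
    by eventually_elim (use that in \<open>simp add: weighted_def restrict_pos_def powr_mult\<close>)
  {
    assume F: "F \<in> RV2 \<alpha> \<rho> A"
    show ?R
    proof (intro allI impI)
      fix x :: real assume x: "x > 0"
      have "((\<lambda>t. (F (t * x) / F t - x powr \<alpha>) / A t) \<longlongrightarrow> x powr \<alpha> * power_kernel \<rho> x) at_top"
        using F x by (auto simp: RV2_def interval_integral_powr_eq_power_kernel)
      then have "((\<lambda>t. x powr \<theta> * ((F (t * x) / F t - x powr \<alpha>) / A t))
          \<longlongrightarrow> x powr \<theta> * (x powr \<alpha> * power_kernel \<rho> x)) at_top"
        by (intro tendsto_intros)
      also have "x powr \<theta> * (x powr \<alpha> * power_kernel \<rho> x) = x powr (\<alpha> + \<theta>) * power_kernel \<rho> x"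
        by (simp add: powr_add)
      finally show "((\<lambda>t. (weighted \<theta> (t * x) / weighted \<theta> t - x powr (\<alpha> + \<theta>)) / restrict_pos A t)
          \<longlongrightarrow> x powr (\<alpha> + \<theta>) * power_kernel \<rho> x) at_top"
      proof (rule Lim_transform_eventually)
        show "\<forall>\<^sub>F t in at_top. x powr \<theta> * ((F (t * x) / F t - x powr \<alpha>) / A t)
            = (weighted \<theta> (t * x) / weighted \<theta> t - x powr (\<alpha> + \<theta>)) / restrict_pos A t"
          using ratio[OF x] eventually_restrict_pos[of A]
          by eventually_elim (simp add: powr_add right_diff_distrib mult.commute)
      qed
    qed
  }
  {
    assume R: ?R
    have "F \<in> RV2 \<alpha> \<rho> (\<lambda>t. 1 * A t)"
    proof (rule RV2_scaledI)
      show "\<forall>\<^sub>F t in at_top. F t > 0"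
        using eventually_gt_at_top[of 0] by eventually_elim (use F_pos in simp)
      fix x :: real assume x: "x > 0"
      have "((\<lambda>t. x powr (-\<theta>) * ((weighted \<theta> (t * x) / weighted \<theta> t - x powr (\<alpha> + \<theta>)) / restrict_pos A t))
          \<longlongrightarrow> x powr (-\<theta>) * (x powr (\<alpha> + \<theta>) * power_kernel \<rho> x)) at_top"
        using R x by (intro tendsto_intros) auto
      also have "x powr (-\<theta>) * (x powr (\<alpha> + \<theta>) * power_kernel \<rho> x) = 1 * (x powr \<alpha> * power_kernel \<rho> x)"
        using x by (simp add: powr_add powr_minus)
      finally show "((\<lambda>t. (F (t * x) / F t - x powr \<alpha>) / restrict_pos A t)
          \<longlongrightarrow> 1 * (x powr \<alpha> * power_kernel \<rho> x)) at_top"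
      proof (rule Lim_transform_eventually)
        show "\<forall>\<^sub>F t in at_top. x powr (-\<theta>) * ((weighted \<theta> (t * x) / weighted \<theta> t - x powr (\<alpha> + \<theta>)) / restrict_pos A t)
            = (F (t * x) / F t - x powr \<alpha>) / restrict_pos A t"
          using ratio[OF x]
        proof eventually_elim
          case (elim t)
          have "x powr (-\<theta>) * x powr \<theta> = 1" using x by (simp add: powr_minus)
          then have "x powr (-\<theta>) * (x powr \<theta> * y - x powr (\<alpha> + \<theta>)) = y - x powr \<alpha>" for y
            using x by (simp add: powr_add algebra_simps)
          then have "x powr (-\<theta>) * ((x powr \<theta> * y - x powr (\<alpha> + \<theta>)) / z) = (y - x powr \<alpha>) / z" for y z
            by (simp only: times_divide_eq_right)
          then show ?case unfolding elim .
        qed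
      qed
    qed (simp_all add: F_measurable)
    then show "F \<in> RV2 \<alpha> \<rho> A" by simp
  }
qed

text \<open>Local boundedness of \<open>F\<close> enters here. It concerns compact subsets of the
  open half-line, which is why b > 0.\<close>

lemma weighted_integrable:
  assumes b: "b > 0"
  shows "set_integrable lborel {b..c} (\<lambda>s. weighted \<theta> s / s)"
proof -
  have "compact {b..c}" "{b..c} \<subseteq> {0<..}" using b by auto
  then have "bounded (F ` {b..c})"
    using F_bounded unfolding locally_bounded_pos_def by blast
  then obtain M where M: "\<And>s. s \<in> {b..c} \<Longrightarrow> \<bar>F s\<bar> \<le> M"
    unfolding bounded_iff real_norm_def by blast
  have "set_integrable lborel {b..c} (restrict_pos F)"
  proof (rule set_integrable_bound)
    show "set_integrable lborel {b..c} (\<lambda>s. M)"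
      by (intro borel_integrable_atLeastAtMost' continuous_intros)
    show "set_borel_measurable lborel {b..c} (restrict_pos F)"
      using F_measurable unfolding measurable_pos_iff set_borel_measurable_def by measurable
    show "AE s in lborel. s \<in> {b..c} \<longrightarrow> norm (restrict_pos F s) \<le> norm M"
    proof (intro AE_I2 impI)
      fix s assume "s \<in> {b..c}"
      then show "norm (restrict_pos F s) \<le> norm M"
        using M[of s] b unfolding real_norm_def restrict_pos_def by auto
    qed
  qed
  then have "set_integrable lborel {b..c} (\<lambda>s. s powr \<theta> / s * restrict_pos F s)"
    using b by (intro set_integrable_continuous_mult continuous_intros) auto
  then show ?thesis by (simp add: weighted_def)
qed

lemma lower_int_eq:
  assumes "t\<^sub>0 \<ge> 0"
  shows "lower_int F \<theta> t\<^sub>0 t = (LINT s:{t\<^sub>0..t}|lborel. weighted \<theta> s / s)"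
  unfolding lower_int_def using assms
  by (intro set_lebesgue_integral_cong) (auto simp: weighted_div)

lemma lower_integrable_iff:
  assumes "t\<^sub>0 \<ge> 0"
  shows "set_integrable lborel {t\<^sub>0..t} (\<lambda>s. s powr (\<theta> - 1) * F s)
      \<longleftrightarrow> set_integrable lborel {t\<^sub>0..t} (\<lambda>s. weighted \<theta> s / s)"
  using assms by (intro set_integrable_cong) (auto simp: weighted_div)

lemma upper_int_eq:
  assumes "t \<ge> 0"
  shows "upper_int F \<theta> t = (LINT s:{t..}|lborel. weighted \<theta> s / s)"
  unfolding upper_int_def using assms
  by (intro set_lebesgue_integral_cong) (auto simp: weighted_div)

lemma upper_integrable_iff:
  assumes "t \<ge> 0"
  shows "set_integrable lborel {t..} (\<lambda>s. s powr (\<theta> - 1) * F s)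
      \<longleftrightarrow> set_integrable lborel {t..} (\<lambda>s. weighted \<theta> s / s)"
  using assms by (intro set_integrable_cong) (auto simp: weighted_div)

lemma lower_int_borel:
  assumes "t\<^sub>0 \<ge> 0"
  shows "lower_int F \<theta> t\<^sub>0 \<in> borel_measurable borel"
proof -
  have "(\<lambda>t. LINT s|lborel. (if t\<^sub>0 \<le> s \<and> s \<le> t then weighted \<theta> s / s else 0)) \<in> borel_measurable borel"
    by (rule lborel.borel_measurable_lebesgue_integral) measurable
  also have "(\<lambda>t. LINT s|lborel. (if t\<^sub>0 \<le> s \<and> s \<le> t then weighted \<theta> s / s else 0)) = lower_int F \<theta> t\<^sub>0"
    unfolding lower_int_eq[OF assms] set_lebesgue_integral_def
    by (intro ext Bochner_Integration.integral_cong) (auto simp: indicator_def)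
  finally show ?thesis .
qed

lemma upper_int_measurable: "measurable_pos (upper_int F \<theta>)"
proof -
  have "(\<lambda>t. LINT s|lborel. (if t \<le> s then weighted \<theta> s / s else 0)) \<in> borel_measurable borel"
    by (rule lborel.borel_measurable_lebesgue_integral) measurable
  then have "measurable_pos (\<lambda>t. LINT s|lborel. (if t \<le> s then weighted \<theta> s / s else 0))"
    by (rule borel_imp_measurable_pos)
  moreover have "restrict_pos (\<lambda>t. LINT s|lborel. (if t \<le> s then weighted \<theta> s / s else 0))
      = restrict_pos (upper_int F \<theta>)"
  proof
    fix t
    have "upper_int F \<theta> t = (LINT s|lborel. (if t \<le> s then weighted \<theta> s / s else 0))" if "t > 0"
      unfolding upper_int_eq[OF less_imp_le[OF that]] set_lebesgue_integral_def
      by (intro Bochner_Integration.integral_cong) (auto simp: indicator_def)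
    then show "restrict_pos (\<lambda>t. LINT s|lborel. (if t \<le> s then weighted \<theta> s / s else 0)) t
      = restrict_pos (upper_int F \<theta>) t" by (simp add: restrict_pos_def)
  qed
  ultimately show ?thesis by (simp add: measurable_pos_iff)
qed

lemma lower_int_increment:
  assumes t0: "t\<^sub>0 \<ge> 0" and int: "\<forall>t\<ge>t\<^sub>0. set_integrable lborel {t\<^sub>0..t} (\<lambda>s. s powr (\<theta> - 1) * F s)"
  shows "\<forall>\<^sub>F t in at_top. \<forall>x\<ge>1. set_integrable lborel {t..t*x} (\<lambda>s. weighted \<theta> s / s) \<and>
      lower_int F \<theta> t\<^sub>0 (t * x) - lower_int F \<theta> t\<^sub>0 t = (LINT s:{t..t*x}|lborel. weighted \<theta> s / s)"
  using eventually_gt_at_top[of t\<^sub>0]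
proof eventually_elim
  case (elim t)
  show ?case
  proof (intro allI impI)
    fix x :: real assume x: "x \<ge> 1"
    have t: "t > 0" "t \<le> t * x" using elim t0 x by auto
    have i1: "set_integrable lborel {t..t*x} (\<lambda>s. weighted \<theta> s / s)"
      using t(1) by (rule weighted_integrable)
    have i2: "set_integrable lborel {t\<^sub>0..t} (\<lambda>s. weighted \<theta> s / s)"
      using int elim lower_integrable_iff[OF t0] by simp
    have "{t\<^sub>0..t*x} = {t\<^sub>0..t} \<union> {t..t*x}"
      using elim t(2) by (intro ivl_disj_un_two_touch(4)[symmetric]) simp_all
    then have "lower_int F \<theta> t\<^sub>0 (t * x)
        = lower_int F \<theta> t\<^sub>0 t + (LINT s:{t..t*x}|lborel. weighted \<theta> s / s)"
      unfolding lower_int_eq[OF t0] using i1 i2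
      by (simp only:) (rule set_integral_adjacent[of _ _ _ t], auto)
    with i1 show "set_integrable lborel {t..t*x} (\<lambda>s. weighted \<theta> s / s) \<and>
      lower_int F \<theta> t\<^sub>0 (t * x) - lower_int F \<theta> t\<^sub>0 t = (LINT s:{t..t*x}|lborel. weighted \<theta> s / s)"
      by simp
  qed
qed

lemma upper_int_increment:
  assumes int: "\<forall>t>0. set_integrable lborel {t..} (\<lambda>s. s powr (\<theta> - 1) * F s)"
  shows "\<forall>\<^sub>F t in at_top. \<forall>x\<ge>1. set_integrable lborel {t..t*x} (\<lambda>s. weighted \<theta> s / s) \<and>
      - upper_int F \<theta> (t * x) - - upper_int F \<theta> t = (LINT s:{t..t*x}|lborel. weighted \<theta> s / s)"
  using eventually_gt_at_top[of 0]
proof eventually_elim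
  case (elim t)
  show ?case
  proof (intro allI impI)
    fix x :: real assume x: "x \<ge> 1"
    have t: "t > 0" "t \<le> t * x" using elim x by auto
    have i1: "set_integrable lborel {t..t*x} (\<lambda>s. weighted \<theta> s / s)"
      using t(1) by (rule weighted_integrable)
    have i2: "set_integrable lborel {t*x..} (\<lambda>s. weighted \<theta> s / s)"
      by (subst upper_integrable_iff[symmetric]) (use int t in auto)
    have "{t..} = {t..t*x} \<union> {t*x..}" using t(2) by (rule atLeast_split)
    then have "upper_int F \<theta> t
        = (LINT s:{t..t*x}|lborel. weighted \<theta> s / s) + upper_int F \<theta> (t * x)"
      using i1 i2 t unfolding upper_int_eq[OF less_imp_le[OF t(1)]]
      by (subst upper_int_eq) (simp, simp only:, rule set_integral_adjacent[of _ _ _ "t*x"], auto)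
    with i1 show "set_integrable lborel {t..t*x} (\<lambda>s. weighted \<theta> s / s) \<and>
      - upper_int F \<theta> (t * x) - - upper_int F \<theta> t = (LINT s:{t..t*x}|lborel. weighted \<theta> s / s)"
      by simp
  qed
qed

lemma lower_int_pos:
  assumes t0: "t\<^sub>0 \<ge> 0" and int: "\<forall>t\<ge>t\<^sub>0. set_integrable lborel {t\<^sub>0..t} (\<lambda>s. s powr (\<theta> - 1) * F s)"
  shows "\<forall>\<^sub>F t in at_top. lower_int F \<theta> t\<^sub>0 t > 0"
  using eventually_gt_at_top[of "t\<^sub>0 + 1"]
proof eventually_elim
  case (elim t)
  \<comment> \<open>Strict positivity is drawn from the points beyond \<open>t\<^sub>0 + 1\<close>:
    at s = 0, which occurs when \<open>t\<^sub>0 = 0\<close>, the integrand vanishes.\<close>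
  have mono: "indicator {t\<^sub>0+1..t} s *\<^sub>R (weighted \<theta> s / s) \<le> indicator {t\<^sub>0..t} s *\<^sub>R (weighted \<theta> s / s)" for s
    using weighted_nonneg[of \<theta> s] t0 by (auto simp: indicator_def intro!: divide_nonneg_nonneg)
  have i1: "set_integrable lborel {t\<^sub>0+1..t} (\<lambda>s. weighted \<theta> s / s)"
    using t0 by (intro weighted_integrable) simp
  have i2: "set_integrable lborel {t\<^sub>0..t} (\<lambda>s. weighted \<theta> s / s)"
    using int elim lower_integrable_iff[OF t0] by simp
  have "0 < (LINT s:{t\<^sub>0+1..t}|lborel. weighted \<theta> s / s)"
    using i1
  proof (rule set_integral_pos)
    show "weighted \<theta> s / s > 0" if "s \<in> {t\<^sub>0+1..t}" for s
      using that t0 weighted_pos[of s \<theta>] by simp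
  qed (use elim in auto)
  also have "\<dots> \<le> (LINT s:{t\<^sub>0..t}|lborel. weighted \<theta> s / s)"
    unfolding set_lebesgue_integral_def using i1 i2 mono
    by (intro integral_mono) (auto simp: set_integrable_def)
  finally show ?case by (simp add: lower_int_eq[OF t0])
qed

lemma upper_int_pos:
  assumes int: "\<forall>t>0. set_integrable lborel {t..} (\<lambda>s. s powr (\<theta> - 1) * F s)"
  shows "\<forall>\<^sub>F t in at_top. upper_int F \<theta> t > 0"
  using eventually_gt_at_top[of 0]
proof eventually_elim
  case (elim t)
  have "set_integrable lborel {t..} (\<lambda>s. weighted \<theta> s / s)"
    by (subst upper_integrable_iff[symmetric]) (use int elim in auto)
  then have "0 < (LINT s:{t..}|lborel. weighted \<theta> s / s)"
  proof (rule set_integral_pos)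
    show "weighted \<theta> s / s > 0" if "s \<in> {t..}" for s
      using that elim weighted_pos[of s \<theta>] by simp
    show "{t..t+1} \<subseteq> {t..}" by auto
  qed auto
  then show ?case using elim by (simp add: upper_int_eq)
qed

lemma lower_karamata_limit_iff:
  "((\<lambda>t. 1 / A t * (t powr \<theta> * F t / H t - a)) \<longlongrightarrow> l) at_top
    \<longleftrightarrow> ((\<lambda>t. (weighted \<theta> t / H t - a) / restrict_pos A t) \<longlongrightarrow> l) at_top"
proof (rule tendsto_cong)
  show "\<forall>\<^sub>F t in at_top. 1 / A t * (t powr \<theta> * F t / H t - a) = (weighted \<theta> t / H t - a) / restrict_pos A t"
    using eventually_gt_at_top[of 0] by eventually_elim (simp add: weighted_def restrict_pos_def)
qed

lemma upper_karamata_limit_iff: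
  "((\<lambda>t. 1 / A t * (t powr \<theta> * F t / H t + a)) \<longlongrightarrow> - l) at_top
    \<longleftrightarrow> ((\<lambda>t. (weighted \<theta> t / (- H t) - a) / restrict_pos A t) \<longlongrightarrow> l) at_top"
proof -
  have "((\<lambda>t. 1 / A t * (t powr \<theta> * F t / H t + a)) \<longlongrightarrow> - l) at_top
    \<longleftrightarrow> ((\<lambda>t. - ((weighted \<theta> t / (- H t) - a) / restrict_pos A t)) \<longlongrightarrow> - l) at_top"
  proof (rule tendsto_cong)
    show "\<forall>\<^sub>F t in at_top. 1 / A t * (t powr \<theta> * F t / H t + a) = - ((weighted \<theta> t / (- H t) - a) / restrict_pos A t)"
      using eventually_gt_at_top[of 0]
    proof eventually_elim
      case (elim t)
      define z where "z = weighted \<theta> t / H t + a"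
      have "weighted \<theta> t / (- H t) - a = - z" by (simp add: z_def)
      moreover have "t powr \<theta> * F t / H t + a = z" "restrict_pos A t = A t"
        using elim by (simp_all add: z_def weighted_def restrict_pos_def)
      ultimately show ?case by simp
    qed
  qed
  then show ?thesis by (simp only: tendsto_minus_cancel_left minus_minus)
qed

section \<open>The implications between the three statements\<close>

lemma RV2_imp_lower_karamata:
  assumes F: "F \<in> RV2 \<alpha> \<rho> A" and \<theta>: "\<theta> > - \<alpha> - \<rho>"
  shows "lower_karamata F \<alpha> \<rho> A \<theta> 1"
proof -
  \<comment> \<open>The starting point 1 is a safe witness: near 0 the integrand may fail to be
    integrable, while on [1, t] local boundedness of \<open>F\<close> suffices.\<close>
  have int: "\<forall>t\<ge>1. set_integrable lborel {1..t} (\<lambda>s. s powr (\<theta> - 1) * F s)"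
    using weighted_integrable lower_integrable_iff by simp
  have "((\<lambda>t. (weighted \<theta> t / lower_int F \<theta> 1 t - (\<alpha> + \<theta>)) / restrict_pos A t)
      \<longlongrightarrow> (\<alpha> + \<theta>) / ((\<alpha> + \<theta>) + \<rho>)) at_top"
  proof (rule karamata_direct)
    show "((\<lambda>t. (weighted \<theta> (t * x) / weighted \<theta> t - x powr (\<alpha> + \<theta>)) / restrict_pos A t)
        \<longlongrightarrow> x powr (\<alpha> + \<theta>) * power_kernel \<rho> x) at_top" if "x \<ge> 1" for x
      using F[unfolded RV2_iff_weighted[of \<alpha> \<theta>]] that by simp
    show "\<forall>\<^sub>F t in at_top. \<forall>x\<ge>1. lower_int F \<theta> 1 (t * x) - lower_int F \<theta> 1 t
        = (LINT s:{t..t*x}|lborel. weighted \<theta> s / s)"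
      using lower_int_increment[OF _ int] by (auto elim: eventually_mono)
    show "\<alpha> + \<theta> > 0 \<and> \<alpha> + \<theta> + \<rho> > 0 \<or> \<alpha> + \<theta> < 0 \<and> \<alpha> + \<theta> + \<rho> < 0 \<and>
        (\<forall>\<^sub>F t in at_top. (\<lambda>n. lower_int F \<theta> 1 (2^n * t)) \<longlonglongrightarrow> 0)"
      using \<theta> \<rho>_le_0 by auto
  qed (auto intro: eventually_weighted_pos)
  then show ?thesis
    unfolding lower_karamata_def lower_karamata_limit_iff using int by simp
qed

lemma lower_karamata_imp_RV2:
  assumes L: "lower_karamata F \<alpha> \<rho> A \<theta> t\<^sub>0" and t0: "t\<^sub>0 \<ge> 0" and \<theta>: "\<theta> > - \<alpha> - \<rho>"
  shows "F \<in> RV2 \<alpha> \<rho> A"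
    and "lower_int F \<theta> t\<^sub>0 \<in> RV2 (\<alpha> + \<theta>) \<rho> (\<lambda>t. (\<alpha> + \<theta>) / (\<alpha> + \<theta> + \<rho>) * A t)"
proof -
  have int: "\<forall>t\<ge>t\<^sub>0. set_integrable lborel {t\<^sub>0..t} (\<lambda>s. s powr (\<theta> - 1) * F s)"
    using L by (simp add: lower_karamata_def)
  have lim: "((\<lambda>t. (weighted \<theta> t / lower_int F \<theta> t\<^sub>0 t - (\<alpha> + \<theta>)) / restrict_pos A t)
      \<longlongrightarrow> (\<alpha> + \<theta>) / ((\<alpha> + \<theta>) + \<rho>)) at_top"
    using L unfolding lower_karamata_def by (simp only: lower_karamata_limit_iff)
  have a: "\<alpha> + \<theta> > 0" "\<alpha> + \<theta> + \<rho> > 0" using \<theta> \<rho>_le_0 by auto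
  have H_pos: "\<forall>\<^sub>F t in at_top. lower_int F \<theta> t\<^sub>0 t > 0" by (rule lower_int_pos[OF t0 int])
  then have H_nz: "\<forall>\<^sub>F t in at_top. lower_int F \<theta> t\<^sub>0 t \<noteq> 0" by eventually_elim simp
  have nz: "\<alpha> + \<theta> \<noteq> 0" "\<alpha> + \<theta> + \<rho> \<noteq> 0" using a by auto
  note conv = karamata_converse[OF weighted_borel lower_int_borel[OF t0] H_nz
      lower_int_increment[OF t0 int] lim nz]
  show "F \<in> RV2 \<alpha> \<rho> A"
    unfolding RV2_iff_weighted[of \<alpha> \<theta>] using conv(2) by blast
  show "lower_int F \<theta> t\<^sub>0 \<in> RV2 (\<alpha> + \<theta>) \<rho> (\<lambda>t. (\<alpha> + \<theta>) / (\<alpha> + \<theta> + \<rho>) * A t)"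
    using a by (intro RV2_scaledI conv(1) H_pos borel_imp_measurable_pos lower_int_borel t0) auto
qed

text \<open>\<theta> < -\<alpha> makes the index of the weighted function negative, hence
  integrability near infinity; local boundedness covers the remaining compact piece. Tails of a
  convergent integral tend to 0, which is the end value required in the decaying case.\<close>

lemma RV2_imp_upper_karamata:
  assumes F: "F \<in> RV2 \<alpha> \<rho> A" and \<theta>: "\<theta> < - \<alpha>"
  shows "upper_karamata F \<alpha> \<rho> A \<theta>"
proof -
  have second: "((\<lambda>t. (weighted \<theta> (t * x) / weighted \<theta> t - x powr (\<alpha> + \<theta>)) / restrict_pos A t)
        \<longlongrightarrow> x powr (\<alpha> + \<theta>) * power_kernel \<rho> x) at_top" if "x \<ge> 1" for x
    using F[unfolded RV2_iff_weighted[of \<alpha> \<theta>]] that by simp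
  have "\<forall>\<^sub>F T in at_top. set_integrable lborel {T..} (\<lambda>s. weighted \<theta> s / s)"
    using regular_variation_integrable_at_top[OF weighted_borel eventually_weighted_pos
        ratio_of_second_order[OF second]] \<theta> by simp
  then obtain T where T: "\<And>t. t \<ge> T \<Longrightarrow> set_integrable lborel {t..} (\<lambda>s. weighted \<theta> s / s)"
    by (auto simp: eventually_at_top_linorder)
  have int_w: "set_integrable lborel {t..} (\<lambda>s. weighted \<theta> s / s)" if "t > 0" for t
  proof -
    have "set_integrable lborel ({t..max T t} \<union> {max T t..}) (\<lambda>s. weighted \<theta> s / s)"
      using that by (intro set_integrable_Un weighted_integrable T) auto
    moreover have "{t..max T t} \<union> {max T t..} = {t..}" by auto
    ultimately show ?thesis by simp
  qed
  then have int: "\<forall>t>0. set_integrable lborel {t..} (\<lambda>s. s powr (\<theta> - 1) * F s)"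
    using upper_integrable_iff by simp
  have null: "(\<lambda>n. - upper_int F \<theta> (2^n * t)) \<longlonglongrightarrow> 0" if t: "t > 0" for t
  proof -
    have "((\<lambda>b. LINT s:{t..b}|lborel. weighted \<theta> s / s) \<longlongrightarrow> (LINT s:{t..}|lborel. weighted \<theta> s / s)) at_top"
      by (rule tendsto_set_lebesgue_integral_at_top) (use int_w[OF t] in auto)
    moreover have "filterlim (\<lambda>n. 2^n * t) at_top sequentially"
    proof (rule filterlim_at_top_mult_tendsto_pos[OF tendsto_const t])
      show "filterlim (\<lambda>n. 2^n :: real) at_top sequentially"
        by (rule filterlim_at_top_mono[OF filterlim_real_sequentially])
          (simp add: less_imp_le of_nat_less_two_power)
    qed
    ultimately have "(\<lambda>n. LINT s:{t..2^n*t}|lborel. weighted \<theta> s / s)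
        \<longlonglongrightarrow> (LINT s:{t..}|lborel. weighted \<theta> s / s)"
      by (rule filterlim_compose)
    then have "(\<lambda>n. (LINT s:{t..2^n*t}|lborel. weighted \<theta> s / s) - (LINT s:{t..}|lborel. weighted \<theta> s / s))
        \<longlonglongrightarrow> 0"
      by (rule LIM_zero)
    also have "(\<lambda>n. (LINT s:{t..2^n*t}|lborel. weighted \<theta> s / s) - (LINT s:{t..}|lborel. weighted \<theta> s / s))
        = (\<lambda>n. - upper_int F \<theta> (2^n * t))"
    proof
      fix n :: nat
      have y: "t \<le> 2^n * t" using t mult_right_mono[of 1 "2^n" t] by simp
      then have Un: "{t..} = {t..2^n*t} \<union> {2^n*t..}" by (rule atLeast_split)
      have "(LINT s:{t..}|lborel. weighted \<theta> s / s)
          = (LINT s:{t..2^n*t}|lborel. weighted \<theta> s / s) + (LINT s:{2^n*t..}|lborel. weighted \<theta> s / s)"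
        unfolding Un using t
        by (intro set_integral_adjacent[of _ _ _ "2^n*t"] weighted_integrable int_w) auto
      then show "(LINT s:{t..2^n*t}|lborel. weighted \<theta> s / s) - (LINT s:{t..}|lborel. weighted \<theta> s / s)
        = - upper_int F \<theta> (2^n * t)"
        using t by (simp add: upper_int_eq)
    qed
    finally show ?thesis .
  qed
  have "((\<lambda>t. (weighted \<theta> t / (- upper_int F \<theta> t) - (\<alpha> + \<theta>)) / restrict_pos A t)
      \<longlongrightarrow> (\<alpha> + \<theta>) / ((\<alpha> + \<theta>) + \<rho>)) at_top"
  proof (rule karamata_direct[OF weighted_borel eventually_weighted_pos second])
    show "\<forall>\<^sub>F t in at_top. \<forall>x\<ge>1. - upper_int F \<theta> (t * x) - - upper_int F \<theta> t
        = (LINT s:{t..t*x}|lborel. weighted \<theta> s / s)"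
      using upper_int_increment[OF int] by (auto elim: eventually_mono)
    have "\<forall>\<^sub>F t in at_top. (\<lambda>n. - upper_int F \<theta> (2^n * t)) \<longlonglongrightarrow> 0"
      using eventually_gt_at_top[of 0] by eventually_elim (rule null)
    then show "\<alpha> + \<theta> > 0 \<and> \<alpha> + \<theta> + \<rho> > 0 \<or> \<alpha> + \<theta> < 0 \<and> \<alpha> + \<theta> + \<rho> < 0 \<and>
        (\<forall>\<^sub>F t in at_top. (\<lambda>n. - upper_int F \<theta> (2^n * t)) \<longlonglongrightarrow> 0)"
      using \<theta> \<rho>_le_0 by auto
  qed
  then show ?thesis
    unfolding upper_karamata_def upper_karamata_limit_iff using int by simp
qed

lemma upper_karamata_imp_RV2:
  assumes U: "upper_karamata F \<alpha> \<rho> A \<theta>" and \<theta>: "\<theta> < - \<alpha>"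
  shows "F \<in> RV2 \<alpha> \<rho> A"
    and "upper_int F \<theta> \<in> RV2 (\<alpha> + \<theta>) \<rho> (\<lambda>t. (\<alpha> + \<theta>) / (\<alpha> + \<theta> + \<rho>) * A t)"
proof -
  have int: "\<forall>t>0. set_integrable lborel {t..} (\<lambda>s. s powr (\<theta> - 1) * F s)"
    using U by (simp add: upper_karamata_def)
  have lim: "((\<lambda>t. (weighted \<theta> t / (- upper_int F \<theta> t) - (\<alpha> + \<theta>)) / restrict_pos A t)
      \<longlongrightarrow> (\<alpha> + \<theta>) / ((\<alpha> + \<theta>) + \<rho>)) at_top"
    using U unfolding upper_karamata_def upper_karamata_limit_iff by simp
  \<comment> \<open>For t < 0 the integral runs over values of \<open>F\<close> about which nothing
    is known. The extension by zero is Borel on the whole line and agrees with the negated integral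
    for t > 0.\<close>
  define H where "H t = - restrict_pos (upper_int F \<theta>) t" for t
  have H_eq: "\<forall>\<^sub>F t in at_top. \<forall>s\<ge>t. H s = - upper_int F \<theta> s"
    using eventually_gt_at_top[of 0] by eventually_elim (simp add: H_def restrict_pos_def)
  have H_borel: "H \<in> borel_measurable borel"
    using upper_int_measurable unfolding H_def measurable_pos_iff by measurable
  have a: "\<alpha> + \<theta> < 0" "\<alpha> + \<theta> + \<rho> < 0" using \<theta> \<rho>_le_0 by auto
  have nz: "\<alpha> + \<theta> \<noteq> 0" "\<alpha> + \<theta> + \<rho> \<noteq> 0" using a by auto
  have G_pos: "\<forall>\<^sub>F t in at_top. upper_int F \<theta> t > 0" by (rule upper_int_pos[OF int])
  then have H_nz: "\<forall>\<^sub>F t in at_top. H t \<noteq> 0"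
    using H_eq by eventually_elim simp
  have incr: "\<forall>\<^sub>F t in at_top. \<forall>x\<ge>1. set_integrable lborel {t..t*x} (\<lambda>s. weighted \<theta> s / s) \<and>
      H (t * x) - H t = (LINT s:{t..t*x}|lborel. weighted \<theta> s / s)"
    using upper_int_increment[OF int] eventually_gt_at_top[of 0]
    by eventually_elim (simp add: H_def restrict_pos_def)
  have H_lim: "((\<lambda>t. (weighted \<theta> t / H t - (\<alpha> + \<theta>)) / restrict_pos A t)
      \<longlongrightarrow> (\<alpha> + \<theta>) / ((\<alpha> + \<theta>) + \<rho>)) at_top"
    using lim
  proof (rule Lim_transform_eventually)
    show "\<forall>\<^sub>F t in at_top. (weighted \<theta> t / (- upper_int F \<theta> t) - (\<alpha> + \<theta>)) / restrict_pos A t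
        = (weighted \<theta> t / H t - (\<alpha> + \<theta>)) / restrict_pos A t"
      using H_eq by eventually_elim simp
  qed
  note conv = karamata_converse[OF weighted_borel H_borel H_nz incr H_lim nz]
  show "F \<in> RV2 \<alpha> \<rho> A"
    unfolding RV2_iff_weighted[of \<alpha> \<theta>] using conv(2) by blast
  show "upper_int F \<theta> \<in> RV2 (\<alpha> + \<theta>) \<rho> (\<lambda>t. (\<alpha> + \<theta>) / (\<alpha> + \<theta> + \<rho>) * A t)"
  proof (rule RV2_scaledI[OF upper_int_measurable G_pos])
    show "0 < (\<alpha> + \<theta>) / (\<alpha> + \<theta> + \<rho>)" using a by (simp add: zero_less_divide_iff)
    fix x :: real assume x: "x > 0"
    from conv(1)[OF x] show "((\<lambda>t. (upper_int F \<theta> (t * x) / upper_int F \<theta> t - x powr (\<alpha> + \<theta>)) / restrict_pos A t)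
        \<longlongrightarrow> (\<alpha> + \<theta>) / (\<alpha> + \<theta> + \<rho>) * (x powr (\<alpha> + \<theta>) * power_kernel \<rho> x)) at_top"
    proof (rule Lim_transform_eventually)
      show "\<forall>\<^sub>F t in at_top. (H (t * x) / H t - x powr (\<alpha> + \<theta>)) / restrict_pos A t
          = (upper_int F \<theta> (t * x) / upper_int F \<theta> t - x powr (\<alpha> + \<theta>)) / restrict_pos A t"
        using eventually_gt_at_top[of 0]
        by eventually_elim (use x in \<open>simp add: H_def restrict_pos_def\<close>)
    qed
  qed
qed

end

theorem proposition3p1:
  fixes F A :: "real \<Rightarrow> real" and \<alpha> \<rho> :: real
  assumes "measurable_pos F"
    and "\<forall>x>0. F x > 0"
    and "locally_bounded_pos F"
    and "\<rho> \<le> 0"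
    and "A \<in> RV_null \<rho>"
  shows "(F \<in> RV2 \<alpha> \<rho> A \<longleftrightarrow> (\<exists>\<theta> > -\<alpha> - \<rho>. \<exists>t\<^sub>0\<ge>0. lower_karamata F \<alpha> \<rho> A \<theta> t\<^sub>0)) \<and>
    (F \<in> RV2 \<alpha> \<rho> A \<longleftrightarrow> (\<forall>\<theta> > -\<alpha> - \<rho>. \<exists>t\<^sub>0\<ge>0. lower_karamata F \<alpha> \<rho> A \<theta> t\<^sub>0)) \<and>
    (\<forall>\<theta> > -\<alpha> - \<rho>. \<forall>t\<^sub>0\<ge>0. lower_karamata F \<alpha> \<rho> A \<theta> t\<^sub>0 \<longrightarrow>
       lower_int F \<theta> t\<^sub>0 \<in> RV2 (\<alpha> + \<theta>) \<rho> (\<lambda>t. (\<alpha> + \<theta>) / (\<alpha> + \<theta> + \<rho>) * A t)) \<and>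
    (F \<in> RV2 \<alpha> \<rho> A \<longleftrightarrow> (\<exists>\<theta> < -\<alpha>. upper_karamata F \<alpha> \<rho> A \<theta>)) \<and>
    (F \<in> RV2 \<alpha> \<rho> A \<longleftrightarrow> (\<forall>\<theta> < -\<alpha>. upper_karamata F \<alpha> \<rho> A \<theta>)) \<and>
    (\<forall>\<theta> < -\<alpha>. upper_karamata F \<alpha> \<rho> A \<theta> \<longrightarrow>
       upper_int F \<theta> \<in> RV2 (\<alpha> + \<theta>) \<rho> (\<lambda>t. (\<alpha> + \<theta>) / (\<alpha> + \<theta> + \<rho>) * A t))"
proof -
  interpret karamata_data F A \<rho>
    using assms by unfold_locales
  have lower: "\<exists>t\<^sub>0\<ge>0. lower_karamata F \<alpha> \<rho> A \<theta> t\<^sub>0" if "F \<in> RV2 \<alpha> \<rho> A" "\<theta> > -\<alpha> - \<rho>" for \<theta>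
    using RV2_imp_lower_karamata[OF that] zero_le_one by blast
  \<comment> \<open>Both ranges of \<theta> are nonempty. This is what produces the existential
    statements from second-order regular variation, and the latter from the universal ones.\<close>
  obtain \<theta>\<^sub>l \<theta>\<^sub>u where \<theta>: "\<theta>\<^sub>l > -\<alpha> - \<rho>" "\<theta>\<^sub>u < -\<alpha>"
    using gt_ex lt_ex by metis
  show ?thesis
  proof (intro conjI iffI)
    show "\<exists>\<theta> > -\<alpha> - \<rho>. \<exists>t\<^sub>0\<ge>0. lower_karamata F \<alpha> \<rho> A \<theta> t\<^sub>0" if "F \<in> RV2 \<alpha> \<rho> A"
      using lower[OF that \<theta>(1)] \<theta>(1) by blast
    show "\<forall>\<theta> > -\<alpha> - \<rho>. \<exists>t\<^sub>0\<ge>0. lower_karamata F \<alpha> \<rho> A \<theta> t\<^sub>0" if "F \<in> RV2 \<alpha> \<rho> A"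
      using lower[OF that] by blast
    show "F \<in> RV2 \<alpha> \<rho> A" if "\<exists>\<theta> > -\<alpha> - \<rho>. \<exists>t\<^sub>0\<ge>0. lower_karamata F \<alpha> \<rho> A \<theta> t\<^sub>0"
      using that lower_karamata_imp_RV2(1) by blast
    show "F \<in> RV2 \<alpha> \<rho> A" if "\<forall>\<theta> > -\<alpha> - \<rho>. \<exists>t\<^sub>0\<ge>0. lower_karamata F \<alpha> \<rho> A \<theta> t\<^sub>0"
      using that \<theta>(1) lower_karamata_imp_RV2(1) by blast
    show "\<forall>\<theta> > -\<alpha> - \<rho>. \<forall>t\<^sub>0\<ge>0. lower_karamata F \<alpha> \<rho> A \<theta> t\<^sub>0 \<longrightarrow>
       lower_int F \<theta> t\<^sub>0 \<in> RV2 (\<alpha> + \<theta>) \<rho> (\<lambda>t. (\<alpha> + \<theta>) / (\<alpha> + \<theta> + \<rho>) * A t)"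
      by (intro allI impI lower_karamata_imp_RV2(2))
    show "\<exists>\<theta> < -\<alpha>. upper_karamata F \<alpha> \<rho> A \<theta>" if "F \<in> RV2 \<alpha> \<rho> A"
      using RV2_imp_upper_karamata[OF that \<theta>(2)] \<theta>(2) by blast
    show "\<forall>\<theta> < -\<alpha>. upper_karamata F \<alpha> \<rho> A \<theta>" if "F \<in> RV2 \<alpha> \<rho> A"
      using RV2_imp_upper_karamata[OF that] by blast
    show "F \<in> RV2 \<alpha> \<rho> A" if "\<exists>\<theta> < -\<alpha>. upper_karamata F \<alpha> \<rho> A \<theta>"
      using that upper_karamata_imp_RV2(1) by blast
    show "F \<in> RV2 \<alpha> \<rho> A" if "\<forall>\<theta> < -\<alpha>. upper_karamata F \<alpha> \<rho> A \<theta>"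
      using that \<theta>(2) upper_karamata_imp_RV2(1) by blast
    show "\<forall>\<theta> < -\<alpha>. upper_karamata F \<alpha> \<rho> A \<theta> \<longrightarrow>
       upper_int F \<theta> \<in> RV2 (\<alpha> + \<theta>) \<rho> (\<lambda>t. (\<alpha> + \<theta>) / (\<alpha> + \<theta> + \<rho>) * A t)"
      by (intro allI impI upper_karamata_imp_RV2(2))
  qed
qed

end
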